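(* Let $K$ be a local field of positive characteristic, let $\Psi=\{\psi^1,\dots,\psi^L\}\subset L^2(K)$ be a finite family and let $c=\{c_{l,j}:1\le l\le L,\ j\in\mathbb{Z}\}$ be a sequence of scalars. Then the weighted co-affine system $X^*(\Psi,c)$ cannot be a frame for $L^2(K)$.
   Context: Local field: a field $K$ with a topology that is locally compact, nondiscrete and totally disconnected; here $K$ has characteristic $p>0$. $dx$ is Haar measure on the additive group $K^+$, and the absolute value is defined by $d(\alpha x)=|\alpha|\,dx$, $|0|=0$; it is ultrametric. $\mathfrak{D}=\{x\in K:|x|\le 1\}$ is the ring of integers, $\mathfrak{P}=\{x\in K:|x|<1\}$ the prime ideal, $\mathfrak{D}^*=\mathfrak{D}\setminus\mathfrak{P}$. $\mathfrak{p}$ is a fixed element of maximal absolute value in $\mathfrak{P}$ (prime element). $\mathfrak{D}/\mathfrak{P}\cong GF(q)$ with $q=p^m$, $m\in\mathbb{N}$; Haar measure is normalized so that $\mathfrak{D}$ has measure $1$; then $|\mathfrak{p}|=q^{-1}$. $\mathbb{N}_0=\mathbb{N}\cup\{0\}$. Translation set: fix $1=\epsilon_0,\epsilon_1,\dots,\epsilon_{m-1}\in\mathfrak{D}^*$ whose $GF(p)$-span is isomorphic to $GF(q)\cong\mathfrak{D}/\mathfrak{P}$ (their classes form a basis of $\mathfrak{D}/\mathfrak{P}$ over $GF(p)$). For $0\le n<q$, write $n=a_0+a_1p+\cdots+a_{m-1}p^{m-1}$ with $0\le a_k<p$, and set $u(n)=(a_0+a_1\epsilon_1+\cdots+a_{m-1}\epsilon_{m-1})\mathfrak{p}^{-1}$.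 For general $n\ge 0$, write $n=b_0+b_1q+\cdots+b_sq^s$ with $0\le b_k<q$, and set $u(n)=u(b_0)+u(b_1)\mathfrak{p}^{-1}+\cdots+u(b_s)\mathfrak{p}^{-s}$. ($\{u(n):n\in\mathbb{N}_0\}$ is a complete list of distinct coset representatives of $\mathfrak{D}$ in $K^+$.) Operators on $L^2(K)$: for $j\in\mathbb{Z}$, $y\in K$, $\delta_jf(x)=q^{j/2}f(\mathfrak{p}^{-j}x)$ and $\tau_yf(x)=f(x-y)$. The weighted co-affine system generated by $\Psi$ and $c$ is the indexed family $$X^*(\Psi,c)=\{\psi^{*l}_{j,k}=c_{l,j}\,\tau_{u(k)}\delta_j\psi^l:\ 1\le l\le L,\ j\in\mathbb{Z},\ k\in\mathbb{N}_0\}.$$ It is a frame for $L^2(K)$ if there are constants $0<A^*\le B^*<\infty$ with $A^*\|f\|_2^2\le\sum_{l=1}^L\sum_{j\in\mathbb{Z}}\sum_{k\in\mathbb{N}_0}|\langle f,\psi^{*l}_{j,k}\rangle|^2\le B^*\|f\|_2^2$ for all $f\in L^2(K)$. *)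

theory Defs
  imports "HOL-Analysis.Analysis"
begin

section \<open>Local fields\<close>

class local_field = field + topological_ab_group_add + topological_comm_monoid_mult +
  assumes tendsto_inverse_nhds: "a \<noteq> 0 \<Longrightarrow> filterlim inverse (nhds (inverse a)) (nhds a)"
    and locally_compact: "\<exists>U C. open U \<and> compact C \<and> x \<in> U \<and> U \<subseteq> C"
    and nondiscrete: "\<exists>S. \<not> open S"
    and totally_disconnected: "connected S \<Longrightarrow> \<exists>a. S \<subseteq> {a}"

definition haar_measure :: "'a::topological_ab_group_add measure \<Rightarrow> bool" where
  "haar_measure M \<longleftrightarrow>
     sets M = sets borel \<and>
     emeasure M UNIV \<noteq> 0 \<and>
     (\<forall>C. compact C \<longrightarrow> emeasure M C < \<infinity>) \<and>
     (\<forall>A\<in>sets M. \<forall>y. emeasure M ((\<lambda>x. y + x) ` A) = emeasure M A) \<and>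
     (\<forall>A\<in>sets M. emeasure M A = (INF U\<in>{U. open U \<and> A \<subseteq> U}. emeasure M U)) \<and>
     (\<forall>U. open U \<longrightarrow> emeasure M U = (SUP C\<in>{C. compact C \<and> C \<subseteq> U}. emeasure M C))"

text \<open>The defining property \<open>d(\<alpha>x) = |\<alpha>| dx\<close>, \<open>|0| = 0\<close>; it determines \<open>av\<close> uniquely from \<open>M\<close>.\<close>

definition haar_abs :: "'a::local_field measure \<Rightarrow> ('a \<Rightarrow> real) \<Rightarrow> bool" where
  "haar_abs M av \<longleftrightarrow>
     av 0 = 0 \<and>
     (\<forall>\<alpha>. \<alpha> \<noteq> 0 \<longrightarrow> (\<forall>A\<in>sets M. emeasure M ((\<lambda>x. \<alpha> * x) ` A) = ennreal (av \<alpha>) * emeasure M A))"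

definition integer_ring :: "('a \<Rightarrow> real) \<Rightarrow> 'a set" where
  "integer_ring av = {x. av x \<le> 1}"

definition prime_ideal :: "('a \<Rightarrow> real) \<Rightarrow> 'a set" where
  "prime_ideal av = {x. av x < 1}"

definition prime_element :: "('a \<Rightarrow> real) \<Rightarrow> 'a \<Rightarrow> bool" where
  "prime_element av \<pi> \<longleftrightarrow> \<pi> \<in> prime_ideal av \<and> (\<forall>x\<in>prime_ideal av. av x \<le> av \<pi>)"

text \<open>
  The set of residue classes \<open>\<DD>/\<PP>\<close>. It is a field, so \<open>\<DD>/\<PP> \<cong> GF(q)\<close> says that it has \<open>q\<close> elements.
\<close>

definition residue_classes :: "('a::plus \<Rightarrow> real) \<Rightarrow> 'a set set" where
  "residue_classes av = (\<lambda>a. (\<lambda>x. a + x) ` prime_ideal av) ` integer_ring av"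

text \<open>
  The classes of \<open>\<epsilon> 0, \<dots>, \<epsilon> (m - 1)\<close> form a basis of \<open>\<DD>/\<PP>\<close> over \<open>GF(p)\<close>, whose elements are
  represented by \<open>0, \<dots>, p - 1\<close>.
\<close>

definition residue_basis :: "('a::field \<Rightarrow> real) \<Rightarrow> nat \<Rightarrow> nat \<Rightarrow> (nat \<Rightarrow> 'a) \<Rightarrow> bool" where
  "residue_basis av p m \<epsilon> \<longleftrightarrow>
     (\<forall>k<m. \<epsilon> k \<in> integer_ring av - prime_ideal av) \<and>
     (\<forall>a. (\<forall>k<m. a k < p) \<and> (\<Sum>k<m. of_nat (a k) * \<epsilon> k) \<in> prime_ideal av \<longrightarrow> (\<forall>k<m. a k = 0)) \<and>
     (\<forall>x\<in>integer_ring av. \<exists>a. (\<forall>k<m. a k < p) \<and> x - (\<Sum>k<m. of_nat (a k) * \<epsilon> k) \<in> prime_ideal av)"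

locale positive_char_local_field =
  fixes M :: "'a::local_field measure"
    and av :: "'a \<Rightarrow> real"
    and p m q :: nat
    and \<epsilon> :: "nat \<Rightarrow> 'a"
    and \<pi> :: 'a
  assumes char_eq: "CHAR('a) = p"
    and char_pos: "p > 0"
    and haar: "haar_measure M"
    and abs: "haar_abs M av"
    and normalized: "emeasure M (integer_ring av) = 1"
    and prime_elt: "prime_element av \<pi>"
    and q_eq: "q = p ^ m"
    and m_pos: "m > 0"
    and residue_card: "card (residue_classes av) = q"
    and eps_0: "\<epsilon> 0 = 1"
    and eps_basis: "residue_basis av p m \<epsilon>"

section \<open>The translation set\<close>

text \<open>\<open>u_digit\<close> is \<open>u(n)\<close> for \<open>n < q\<close>, and \<open>coset_rep\<close> below is \<open>u(n)\<close> for all \<open>n\<close>;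
  \<open>(n div p ^ k) mod p\<close> is the digit \<open>a\<^sub>k\<close> of \<open>n\<close> in base \<open>p\<close>.\<close>

definition u_digit :: "nat \<Rightarrow> nat \<Rightarrow> (nat \<Rightarrow> 'a::field) \<Rightarrow> 'a \<Rightarrow> nat \<Rightarrow> 'a" where
  "u_digit p m \<epsilon> \<pi> n = (\<Sum>k<m. of_nat ((n div p ^ k) mod p) * \<epsilon> k) * inverse \<pi>"

text \<open>
  The sum may run up to \<open>k = n\<close>: for \<open>q \<ge> 2\<close> the base-\<open>q\<close> digits of \<open>n\<close> with index greater than \<open>n\<close>
  vanish, and zero digits contribute \<open>u_digit 0 = 0\<close>.
\<close>

definition coset_rep :: "nat \<Rightarrow> nat \<Rightarrow> nat \<Rightarrow> (nat \<Rightarrow> 'a::field) \<Rightarrow> 'a \<Rightarrow> nat \<Rightarrow> 'a" where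
  "coset_rep p m q \<epsilon> \<pi> n = (\<Sum>k\<le>n. u_digit p m \<epsilon> \<pi> ((n div q ^ k) mod q) * inverse \<pi> ^ k)"

section \<open>The space of square-integrable functions\<close>

definition L2 :: "'a measure \<Rightarrow> ('a \<Rightarrow> complex) set" where
  "L2 M = {f \<in> borel_measurable M. integrable M (\<lambda>x. (cmod (f x))\<^sup>2)}"

definition L2_inner :: "'a measure \<Rightarrow> ('a \<Rightarrow> complex) \<Rightarrow> ('a \<Rightarrow> complex) \<Rightarrow> complex" where
  "L2_inner M f g = (LINT x|M. f x * cnj (g x))"

definition L2_norm :: "'a measure \<Rightarrow> ('a \<Rightarrow> complex) \<Rightarrow> real" where
  "L2_norm M f = sqrt (LINT x|M. (cmod (f x))\<^sup>2)"

section \<open>Weighted co-affine systems and frames\<close>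

definition dilation :: "nat \<Rightarrow> 'a::field \<Rightarrow> int \<Rightarrow> ('a \<Rightarrow> complex) \<Rightarrow> 'a \<Rightarrow> complex" where
  "dilation q \<pi> j f = (\<lambda>x. of_real (real q powr (of_int j / 2)) * f (\<pi> powi (- j) * x))"

definition translation :: "'a::field \<Rightarrow> ('a \<Rightarrow> complex) \<Rightarrow> 'a \<Rightarrow> complex" where
  "translation y f = (\<lambda>x. f (x - y))"

definition weighted_coaffine_system ::
    "nat \<Rightarrow> nat \<Rightarrow> nat \<Rightarrow> (nat \<Rightarrow> 'a::field) \<Rightarrow> 'a \<Rightarrow> (nat \<Rightarrow> 'a \<Rightarrow> complex) \<Rightarrow> (nat \<Rightarrow> int \<Rightarrow> complex)
     \<Rightarrow> nat \<Rightarrow> int \<Rightarrow> nat \<Rightarrow> 'a \<Rightarrow> complex" where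
  "weighted_coaffine_system p m q \<epsilon> \<pi> \<psi> c l j k =
     (\<lambda>x. c l j * translation (coset_rep p m q \<epsilon> \<pi> k) (dilation q \<pi> j (\<psi> l)) x)"

text \<open>
  The sum is taken in \<^typ>\<open>ennreal\<close>, where it always exists; the upper bound forces it to be finite.
\<close>

definition is_frame :: "'a measure \<Rightarrow> nat \<Rightarrow> (nat \<Rightarrow> int \<Rightarrow> nat \<Rightarrow> 'a \<Rightarrow> complex) \<Rightarrow> bool" where
  "is_frame M L \<phi> \<longleftrightarrow>
     (\<exists>A B :: real. 0 < A \<and> A \<le> B \<and>
        (\<forall>f\<in>L2 M.
           let S = (\<Sum>l=1..L. \<Sum>\<^sub>\<infinity>j\<in>UNIV. \<Sum>\<^sub>\<infinity>k\<in>UNIV. ennreal ((cmod (L2_inner M f (\<phi> l j k)))\<^sup>2))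
           in ennreal (A * (L2_norm M f)\<^sup>2) \<le> S \<and> S \<le> ennreal (B * (L2_norm M f)\<^sup>2)))"

end

theory Submission
  imports Defs "HOL-Number_Theory.Cong"
begin

text \<open>
  Testing the upper frame bound on \<open>\<psi>\<^sup>*\<^bsub>l,j,0\<^esub>\<close> itself gives
  \<open>\<parallel>\<psi>\<^sup>*\<^bsub>l,j,0\<^esub>\<parallel>\<^sup>2 \<le> B\<close>, so the weights are controlled uniformly in \<open>j\<close>.
  Now test the frame on the Haar wavelet \<open>f\<close> at scale \<open>s\<close> (the difference of the indicators of two
  cosets of \<open>\<pi>\<^sup>s\<PP>\<close> in \<open>\<pi>\<^sup>s\<DD>\<close>), translated by \<open>1, \<pi>, \<dots>, \<pi>\<^bsup>s-1\<^esup>\<close>. Moving dilations and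
  translations to the other side of the inner product turns the coefficients against
  \<open>\<psi>\<^sup>*\<^bsub>l,j,k\<^esub>\<close> into coefficients of \<open>\<psi>\<^sup>l\<close> against wavelets that are pairwise orthogonal
  over all \<open>j\<close>, \<open>k\<close> and all translates, because the \<open>u k\<close> are incongruent modulo \<open>\<DD>\<close> and the
  \<open>\<pi>\<^sup>i\<close>, \<open>i < s\<close>, modulo \<open>\<pi>\<^sup>s\<DD>\<close>. Bessel's inequality then bounds the total frame sum of the \<open>s\<close>
  translates by \<open>L B \<parallel>f\<parallel>\<^sup>2\<close>, whereas the lower frame bound makes it at least \<open>s A \<parallel>f\<parallel>\<^sup>2\<close>; let
  \<open>s \<rightarrow> \<infinity>\<close>.

  That \<open>av\<close> is ultrametric has to be derived from its definition by Haar measure: it satisfies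
  \<open>av (x + y) \<le> C max (av x) (av y)\<close> because \<open>\<DD>\<close> is relatively compact, and raising to the powers
  \<open>p\<^sup>n\<close> (Frobenius) removes the constant.
\<close>

section \<open>Topology and absolute value\<close>

lemma open_preimage_mult:
  fixes a :: "'a::local_field"
  assumes "open U" shows "open {x. a * x \<in> U}"
proof -
  have "continuous_on UNIV (\<lambda>x. a * x)" by (intro continuous_intros)
  from open_vimage[OF assms this] show ?thesis by (simp add: vimage_def)
qed

lemma mult_image_eq:
  fixes a :: "'a::field"
  assumes "a \<noteq> 0" shows "(*) a ` U = {x. inverse a * x \<in> U}"
proof safe
  fix x assume "inverse a * x \<in> U"
  then have "a * (inverse a * x) \<in> (*) a ` U" by (rule imageI)
  then show "x \<in> (*) a ` U" using assms by (simp flip: mult.assoc)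
qed (use assms in \<open>simp flip: mult.assoc\<close>)

lemma open_image_mult:
  fixes a :: "'a::local_field"
  assumes "open U" "a \<noteq> 0" shows "open ((*) a ` U)"
proof -
  have "(*) a ` U = {x. inverse a * x \<in> U}"
    using mult_image_eq[OF assms(2)] .
  then show ?thesis using open_preimage_mult[OF assms(1)] by simp
qed

lemma open_preimage_affine:
  fixes a b :: "'a::local_field"
  assumes "open U" shows "open {x. a * x + b \<in> U}"
proof -
  have "continuous_on UNIV (\<lambda>x. a * x + b)" by (intro continuous_intros)
  from open_vimage[OF assms this] show ?thesis by (simp add: vimage_def)
qed

text \<open>The pair {0, z} is disconnected, so two open sets split it; the one that contains 0
  misses z.\<close>

lemma separating_nhd_zero:
  fixes z :: "'a::local_field"
  assumes "z \<noteq> 0"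
  obtains N where "open N" "0 \<in> N" "z \<notin> N"
proof -
  have "\<not> connected {0, z}" using totally_disconnected[of "{0,z}"] assms by auto
  then obtain A B where AB: "open A" "open B" "{0,z} \<subseteq> A \<union> B" "A \<inter> B \<inter> {0,z} = {}" "A \<inter> {0,z} \<noteq> {}" "B \<inter> {0,z} \<noteq> {}"
    unfolding connected_def by meson
  show thesis
  proof (cases "0 \<in> A")
    case True then show thesis using AB that[of A] by blast
  next
    case False then show thesis using AB that[of B] by blast
  qed
qed

text \<open>Continuity of subtraction carries the separation of x - y from 0 over to x and y: all
  differences a - b with a in A and b in B avoid x - y, so the translates x + B and y + A are
  disjoint. Hausdorffness makes compact sets closed, hence Borel.\<close>

instance local_field \<subseteq> t2_space
proof
  fix x y :: 'a
  assume "x \<noteq> y"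
  then have "x - y \<noteq> 0" by simp
  from separating_nhd_zero[OF this] obtain N where N: "open N" "0 \<in> N" "x - y \<notin> N"
    by blast
  have "continuous_on UNIV (\<lambda>u::'a \<times> 'a. fst u - snd u)" by (intro continuous_intros)
  from open_vimage[OF N(1) this] have "open {u::'a \<times> 'a. fst u - snd u \<in> N}" by (simp add: vimage_def)
  moreover have "(0, 0) \<in> {u::'a \<times> 'a. fst u - snd u \<in> N}" using N(2) by simp
  ultimately obtain A B where AB: "open A" "open B" "(0,0) \<in> A \<times> B" "A \<times> B \<subseteq> {u. fst u - snd u \<in> N}"
    by (rule open_prod_elim)
  let ?U = "{t. 1 * t + (- x) \<in> B}" and ?V = "{t. 1 * t + (- y) \<in> A}"
  have "?U \<inter> ?V = {}"
  proof (rule ccontr)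
    assume "?U \<inter> ?V \<noteq> {}"
    then obtain t where "t - x \<in> B" "t - y \<in> A" by auto
    then have "(t - y) - (t - x) \<in> N" using AB(4) by fastforce
    then show False using N(3) by simp
  qed
  moreover have "open ?U" "open ?V" using AB open_preimage_affine by blast+
  moreover have "x \<in> ?U" "y \<in> ?V" using AB(3) by auto
  ultimately show "\<exists>U V. open U \<and> open V \<and> x \<in> U \<and> y \<in> V \<and> U \<inter> V = {}" by blast
qed

lemma compact_nhd_zero:
  obtains U V :: "'a::local_field set" where "open U" "0 \<in> U" "U \<subseteq> V" "compact V"
  using locally_compact[of "0::'a"] by blast

text \<open>If {0} were open, translation would make every singleton open and the topology
  discrete.\<close>

lemma nonzero_in_nhd_zero:
  fixes U :: "'a::local_field set"
  assumes "open U" "0 \<in> U"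
  obtains x where "x \<in> U" "x \<noteq> 0"
proof -
  have False if "U = {0}"
  proof -
    have "open {x}" for x :: 'a
    proof -
      have "{t. 1 * t + (- x) \<in> U} = {x}" using that by auto
      then show ?thesis using open_preimage_affine[OF assms(1), of 1 "- x"] by simp
    qed
    then have "open S" for S :: "'a set" using open_UN[of S "\<lambda>x. {x}"] by simp
    then show False using nondiscrete[where 'a='a] by blast
  qed
  then show thesis using that assms by blast
qed

lemma compact_mult_set:
  fixes V C :: "'a::local_field set"
  assumes "compact V" "compact C"
  shows "compact ((\<lambda>u. fst u * snd u) ` (V \<times> C))"
  by (intro compact_continuous_image compact_Times assms continuous_intros)

lemma compact_inverse_image:
  fixes V :: "'a::local_field set"
  assumes "compact V" "0 \<notin> V"
  shows "compact (inverse ` V)"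
proof (rule compact_continuous_image[OF _ assms(1)])
  show "continuous_on V inverse"
    unfolding continuous_on_def
  proof
    fix x assume "x \<in> V"
    then have "x \<noteq> 0" using assms by auto
    from tendsto_inverse_nhds[OF this]
    show "(inverse \<longlongrightarrow> inverse x) (at x within V)"
      by (rule tendsto_mono[rotated]) (simp add: at_within_def)
  qed
qed

text \<open>The tube lemma around {0} x V: compactness of V gives one W that serves all v.\<close>

lemma mult_into_open:
  fixes V U :: "'a::local_field set"
  assumes "compact V" "open U" "0 \<in> U"
  obtains W where "open W" "0 \<in> W" "\<And>w v. w \<in> W \<Longrightarrow> v \<in> V \<Longrightarrow> w * v \<in> U"
proof -
  have "continuous_on UNIV (\<lambda>u::'a \<times> 'a. fst u * snd u)" by (intro continuous_intros)
  from open_vimage[OF assms(2) this] have "open {u::'a \<times> 'a. fst u * snd u \<in> U}" by (simp add: vimage_def)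
  moreover have "{0} \<times> V \<subseteq> {u::'a \<times> 'a. fst u * snd u \<in> U}" using assms(3) by auto
  ultimately have "\<exists>W. 0 \<in> W \<and> open W \<and> W \<times> V \<subseteq> {u. fst u * snd u \<in> U}"
    by (rule Elementary_Topology.tube_lemma[OF assms(1)])
  then obtain W where W: "0 \<in> W" "open W" "W \<times> V \<subseteq> {u. fst u * snd u \<in> U}" by (elim exE conjE)
  show thesis
  proof (rule that[OF W(2,1)])
    fix w v assume "w \<in> W" "v \<in> V"
    then have "(w, v) \<in> {u. fst u * snd u \<in> U}" using W(3) by (intro subsetD[OF W(3)] SigmaI)
    then show "w * v \<in> U" by simp
  qed
qed

section \<open>The absolute value as the modulus of Haar measure\<close>

context positive_char_local_field
begin

abbreviation "D \<equiv> integer_ring av"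
abbreviation "P \<equiv> prime_ideal av"

lemma sets_eq: "sets M = sets borel" using haar by (simp add: haar_measure_def)
lemma space_eq: "space M = UNIV" using sets_eq_imp_space_eq[OF sets_eq] by simp

lemma compact_finite: "compact C \<Longrightarrow> emeasure M C < \<infinity>"
  using haar by (simp add: haar_measure_def)

lemma compact_sets: "compact (C::'a set) \<Longrightarrow> C \<in> sets M"
  by (simp add: sets_eq compact_imp_closed)

lemma emeasure_translate:
  "A \<in> sets M \<Longrightarrow> emeasure M ((\<lambda>x. y + x) ` A) = emeasure M A"
  using haar by (simp add: haar_measure_def)

lemma emeasure_dilate:
  "\<alpha> \<noteq> 0 \<Longrightarrow> A \<in> sets M \<Longrightarrow> emeasure M ((\<lambda>x. \<alpha> * x) ` A) = ennreal (av \<alpha>) * emeasure M A"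
  using abs by (simp add: haar_abs_def)

lemma av_0 [simp]: "av 0 = 0" using abs by (simp add: haar_abs_def)

text \<open>A nonmeasurable set has \<open>emeasure\<close> 0 by default, whereas the normalization
  gives 1.\<close>

lemma D_sets: "D \<in> sets M"
  using normalized emeasure_notin_sets[of D M] by auto

lemma image_mult_sets:
  assumes "\<alpha> \<noteq> 0" "A \<in> sets M" shows "(\<lambda>x. \<alpha> * x) ` A \<in> sets M"
proof -
  have "continuous_on UNIV (\<lambda>x. inverse \<alpha> * x)" by (intro continuous_intros)
  then have "(\<lambda>x. inverse \<alpha> * x) \<in> measurable borel borel" by (rule borel_measurable_continuous_onI)
  then have "(\<lambda>x. inverse \<alpha> * x) -` A \<inter> space borel \<in> sets borel"
    by (rule measurable_sets) (use assms sets_eq in simp)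
  moreover have "(\<lambda>x. inverse \<alpha> * x) -` A = (\<lambda>x. \<alpha> * x) ` A"
    by (simp only: mult_image_eq[OF assms(1)] vimage_def)
  ultimately show ?thesis by (simp add: sets_eq)
qed

lemma ennreal_av: "\<alpha> \<noteq> 0 \<Longrightarrow> emeasure M ((\<lambda>x. \<alpha> * x) ` D) = ennreal (av \<alpha>)"
  using emeasure_dilate[OF _ D_sets] normalized by simp

text \<open>The scaling property is applied to D twice. The sign of \<open>av\<close> is still
  unknown here, and \<open>ennreal\<close> sends negative numbers to 0, so the identity is first
  obtained in this truncated form.\<close>

lemma av_mult_ennreal:
  assumes "\<alpha> \<noteq> 0" "\<beta> \<noteq> 0"
  shows "ennreal (av (\<alpha> * \<beta>)) = ennreal (av \<alpha>) * ennreal (av \<beta>)"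
proof -
  have "(\<lambda>x. (\<alpha> * \<beta>) * x) ` D = (\<lambda>x. \<alpha> * x) ` (\<lambda>x. \<beta> * x) ` D"
    by (simp add: image_image mult.assoc)
  then show ?thesis
    using ennreal_av[of "\<alpha> * \<beta>"] emeasure_dilate[OF assms(1) image_mult_sets[OF assms(2) D_sets]]
      ennreal_av[OF assms(2)] assms by simp
qed

lemma av_1 [simp]: "av 1 = 1"
  using ennreal_av[of 1] normalized by (simp add: ennreal_eq_1)

text \<open>A nonpositive value is truncated to 0; multiplicativity would then give 1 = \<alpha> *
  \<open>inverse\<close> \<alpha> the value 0.\<close>

lemma av_pos: assumes "\<alpha> \<noteq> 0" shows "av \<alpha> > 0"
proof (rule ccontr)
  assume "\<not> ?thesis"
  then have "ennreal (av \<alpha>) = 0" by (simp add: ennreal_neg)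
  then have "ennreal (av (\<alpha> * inverse \<alpha>)) = 0"
    using av_mult_ennreal[of \<alpha> "inverse \<alpha>"] assms by simp
  then show False using assms by simp
qed

lemma av_nonneg [simp]: "av \<alpha> \<ge> 0"
  using av_pos[of \<alpha>] by (cases "\<alpha> = 0") auto

lemma av_eq_0 [simp]: "av \<alpha> = 0 \<longleftrightarrow> \<alpha> = 0"
  using av_pos[of \<alpha>] by (cases "\<alpha> = 0") auto

lemma av_mult [simp]: "av (\<alpha> * \<beta>) = av \<alpha> * av \<beta>"
proof (cases "\<alpha> = 0 \<or> \<beta> = 0")
  case False
  then have "ennreal (av (\<alpha> * \<beta>)) = ennreal (av \<alpha> * av \<beta>)"
    using av_mult_ennreal by (simp add: ennreal_mult)
  then show ?thesis by (simp add: ennreal_inj)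
qed auto

lemma av_power [simp]: "av (\<alpha> ^ n) = av \<alpha> ^ n" by (induction n) auto

lemma av_inverse [simp]: "av (inverse \<alpha>) = inverse (av \<alpha>)"
proof (cases "\<alpha> = 0")
  case False
  then have "av \<alpha> * av (inverse \<alpha>) = 1" by (simp flip: av_mult)
  then show ?thesis by (metis inverse_unique)
qed auto

lemma av_divide [simp]: "av (\<alpha> / \<beta>) = av \<alpha> / av \<beta>"
  by (simp add: divide_inverse)

lemma av_minus [simp]: "av (- \<alpha>) = av \<alpha>"
proof -
  have "av (- 1) * av (- 1) = 1" by (simp flip: av_mult)
  then have "av (- 1) = 1"
    using av_nonneg[of "-1"] by (metis abs_of_nonneg power2_eq_square power2_eq_1_iff abs_minus_cancel abs_one)
  then show ?thesis using av_mult[of "-1" \<alpha>] by simp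
qed

lemma av_powi [simp]: "av (\<alpha> powi n) = av \<alpha> powi n"
  by (cases "n \<ge> 0") (simp_all add: power_int_def)

text \<open>Inner regularity gives a compact C of positive measure. For x in V the set x C lies in
  the compact product V C, so |x| is at most the ratio of the measures of V C and C.\<close>

lemma av_bounded_on_compact:
  assumes "compact V"
  obtains B where "B > 0" "\<And>x. x \<in> V \<Longrightarrow> av x \<le> B"
proof -
  have "emeasure M UNIV \<noteq> 0" using haar unfolding haar_measure_def by blast
  moreover have "emeasure M UNIV = (SUP C\<in>{C. compact C \<and> C \<subseteq> UNIV}. emeasure M C)"
    using haar unfolding haar_measure_def by blast
  ultimately obtain C where C: "compact C" "emeasure M C \<noteq> 0"
    by (metis (no_types, lifting) SUP_bot_conv(1) bot_ennreal mem_Collect_eq)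
  let ?VC = "(\<lambda>u. fst u * snd u) ` (V \<times> C)"
  have VC: "compact ?VC" using compact_mult_set[OF assms C(1)] .
  obtain c where c: "emeasure M C = ennreal c" "c > 0"
    using C compact_finite[OF C(1)] by (cases "emeasure M C") (auto simp: less_le)
  obtain d where d: "emeasure M ?VC = ennreal d" "d \<ge> 0"
    using compact_finite[OF VC] by (cases "emeasure M ?VC") auto
  have "av x \<le> d / c" if "x \<in> V" for x
  proof (cases "x = 0")
    case True then show ?thesis using c d by simp
  next
    case False
    have "ennreal (av x) * emeasure M C = emeasure M ((\<lambda>y. x * y) ` C)"
      using emeasure_dilate[OF False compact_sets[OF C(1)]] by simp
    also have "\<dots> \<le> emeasure M ?VC"
      using that by (intro emeasure_mono compact_sets VC) (auto simp: image_iff intro!: bexI)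
    finally have "av x * c \<le> d" using c d by (simp flip: ennreal_mult)
    then show ?thesis using c by (simp add: field_simps)
  qed
  moreover have "0 < d / c + 1" using c d by (simp add: add_nonneg_pos)
  ultimately show thesis using that[of "d / c + 1"] by fastforce
qed

lemma av_bounded_below_on_compact:
  assumes "compact V" "0 \<notin> V"
  obtains b where "b > 0" "\<And>x. x \<in> V \<Longrightarrow> av x \<ge> b"
proof -
  obtain B where B: "B > 0" "\<And>x. x \<in> inverse ` V \<Longrightarrow> av x \<le> B"
    using av_bounded_on_compact[OF compact_inverse_image[OF assms]] by blast
  have "av x \<ge> 1 / B" if "x \<in> V" for x
  proof -
    have "inverse (av x) \<le> B" using B(2)[of "inverse x"] that by simp
    moreover have "av x > 0" using that assms av_pos by metis
    ultimately show ?thesis using B(1) by (simp add: field_simps)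
  qed
  then show thesis using that[of "1 / B"] B(1) by simp
qed

text \<open>\<open>card\<close> of an infinite set is 0, whereas q is a power of p > 0.\<close>

lemma finite_residue_classes: "finite (residue_classes av)"
  using residue_card q_eq char_pos by (metis card.infinite power_not_zero less_numeral_extra(3))

text \<open>If \<pi> = 0, then P = {0} and every nonzero element has value 1, so D is the whole
  field and its residue classes are singletons. The field is then finite and, being Hausdorff,
  discrete.\<close>

lemma pi_nz [simp]: "\<pi> \<noteq> 0"
proof
  assume pi0: "\<pi> = 0"
  have P0: "av x = 0" if "av x < 1" for x
    using prime_elt that pi0 unfolding prime_element_def prime_ideal_def
    by (metis av_0 av_nonneg mem_Collect_eq order_antisym)
  have av1: "av x = 1" if "x \<noteq> 0" for x
  proof -
    have "\<not> av x < 1" using P0[of x] that by auto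
    moreover have "\<not> av (inverse x) < 1" using P0[of "inverse x"] that by auto
    ultimately show ?thesis using av_pos[OF that] by (simp add: not_less one_le_inverse_iff)
  qed
  have "P = {0}" unfolding prime_ideal_def using P0 by auto
  then have "residue_classes av = (\<lambda>a. {a}) ` D" unfolding residue_classes_def by simp
  then have "finite ((\<lambda>a. {a}) ` D)" using finite_residue_classes by simp
  then have "finite D" by (rule finite_imageD) (simp add: inj_on_def)
  moreover have "D = UNIV" unfolding integer_ring_def using av1 av_0 by (auto, metis order_refl zero_le_one)
  ultimately have fin: "finite (UNIV :: 'a set)" by simp
  have "closed (S :: 'a set)" for S using fin by (intro finite_imp_closed) (auto intro: finite_subset)
  then have "open (S :: 'a set)" for S by (simp add: open_closed)
  then show False using nondiscrete[where 'a='a] by blast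
qed

lemma av_pi: "0 < av \<pi>" "av \<pi> < 1"
  using prime_elt av_pos[of \<pi>] by (auto simp: prime_element_def prime_ideal_def)

text \<open>It is not yet known that powers of \<pi> tend to 0 in the topology. Instead n is fixed
  first, from a bound of \<open>av\<close> on a neighbourhood U, and then a nonzero w in U is chosen
  so small that \<pi>^n w lies in W.\<close>

lemma ex_contracting:
  fixes W :: "'a set"
  assumes "open W" "0 \<in> W"
  obtains r where "r \<in> W" "r \<noteq> 0" "av r < 1"
proof -
  obtain U V :: "'a set" where UV: "open U" "0 \<in> U" "U \<subseteq> V" "compact V" using compact_nhd_zero .
  obtain B where B: "B > 0" "\<And>x. x \<in> V \<Longrightarrow> av x \<le> B" using av_bounded_on_compact[OF UV(4)] by blast
  obtain n where n: "av \<pi> ^ n < 1 / B"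
    using real_arch_pow_inv[of "1 / B" "av \<pi>"] B(1) av_pi by auto
  have "open ({x. \<pi> ^ n * x \<in> W} \<inter> U)" "0 \<in> {x. \<pi> ^ n * x \<in> W} \<inter> U"
    using open_preimage_mult[OF assms(1)] UV assms by auto
  then obtain w where w: "w \<noteq> 0" "\<pi> ^ n * w \<in> W" "w \<in> U" using nonzero_in_nhd_zero by blast
  have "av (\<pi> ^ n * w) \<le> av \<pi> ^ n * B"
    using B(2)[of w] w UV by (auto intro!: mult_left_mono)
  also have "\<dots> < 1" using n B(1) by (simp add: field_simps)
  finally show thesis using that[of "\<pi> ^ n * w"] w by simp
qed

text \<open>If multiplication by \<open>r\<close> shrinks a compact neighbourhood \<open>V\<close> of \<open>0\<close>, then the powers of \<open>r\<close>
  carry any \<open>x\<close> into \<open>V\<close>, entering through the shell \<open>V - r V\<close>; there \<open>av\<close> is bounded below, so for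
  \<open>x \<in> D\<close> the number of steps is bounded.\<close>

lemma D_subset_compact:
  obtains K where "compact K" "D \<subseteq> K"
proof -
  obtain U V :: "'a set" where UV: "open U" "0 \<in> U" "U \<subseteq> V" "compact V" using compact_nhd_zero .
  obtain W where W: "open W" "0 \<in> W" "\<And>w v. w \<in> W \<Longrightarrow> v \<in> V \<Longrightarrow> w * v \<in> U"
    using mult_into_open[OF UV(4) UV(1,2)] by blast
  obtain r where r: "r \<in> W" "r \<noteq> 0" "av r < 1" using ex_contracting[OF W(1,2)] .
  \<comment> \<open>The image of the open set U is removed, so that the shell stays compact; it
    omits 0 because 0 lies in U.\<close>
  obtain b where b: "b > 0" "\<And>x. x \<in> V - (*) r ` U \<Longrightarrow> av x \<ge> b"
    using av_bounded_below_on_compact[of "V - (*) r ` U"] compact_diff[OF UV(4) open_image_mult[OF UV(1) r(2)]] UV(2)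
    by (metis Diff_iff image_eqI mult_zero_right)
  obtain N where N: "av r ^ N < b" using real_arch_pow_inv[OF b(1) r(3)] by auto
  obtain v where vU: "v \<in> U" "v \<noteq> 0" by (rule nonzero_in_nhd_zero[OF UV(1,2)])
  with UV(3) have v: "v \<in> V" "v \<noteq> 0" by auto
  have inV: "r ^ k * v \<in> V" for k
    using v W(3)[OF r(1)] UV(3) by (induction k) (auto simp: mult.assoc)
  \<comment> \<open>The powers r^k v stay in V while their values tend to 0. Outside the
    neighbourhood ?G of 0 the values on V are bounded below, so some r^n v lies in ?G, which says
    that r^n x lies in U.\<close>
  have enter: "\<exists>n. r ^ n * x \<in> V" for x
  proof -
    let ?G = "{t. inverse v * x * t \<in> U}"
    have "open ?G" using open_preimage_mult[OF UV(1)] .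
    then have G: "compact (V - ?G)" "0 \<notin> V - ?G" using UV(2,4) compact_diff by auto
    obtain d where d: "d > 0" "\<And>t. t \<in> V - ?G \<Longrightarrow> av t \<ge> d"
      using av_bounded_below_on_compact[OF G] by blast
    obtain n where n: "av r ^ n < d / av v"
      using real_arch_pow_inv[of "d / av v" "av r"] d(1) r(3) av_pos[OF v(2)] by auto
    then have "av (r ^ n * v) < d" using av_pos[OF v(2)] by (simp add: field_simps)
    then have "r ^ n * v \<in> ?G" using d(2)[of "r ^ n * v"] inV by force
    then have "r ^ n * x \<in> U" using v(2) by (simp add: field_simps)
    then show ?thesis using UV(3) by blast
  qed
  have cover: "\<exists>n\<le>N. r ^ n * x \<in> V" if x: "x \<in> D" for x
  proof -
    define n where "n = (LEAST n. r ^ n * x \<in> V)"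
    have n: "r ^ n * x \<in> V" unfolding n_def using enter LeastI_ex by metis
    show ?thesis
    proof (cases n)
      case 0 then show ?thesis using n by auto
    next
      case (Suc k)
      then have "r ^ k * x \<notin> V" unfolding n_def by (metis lessI not_less_Least)
      then have "r ^ n * x \<notin> (*) r ` U" using Suc UV(3) r(2) by (auto simp: mult.assoc)
      then have "b \<le> av r ^ n * av x" using b(2)[of "r ^ n * x"] n by simp
      also have "\<dots> \<le> av r ^ n" using x by (simp add: integer_ring_def mult_left_le)
      finally have "av r ^ N < av r ^ n" using N by simp
      then have "n \<le> N" by (metis r(3) av_nonneg less_imp_le linorder_not_le nle_le power_decreasing)
      then show ?thesis using n by blast
    qed
  qed
  let ?K = "\<Union>n\<le>N. (*) (inverse (r ^ n)) ` V"
  have "compact ?K"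
    by (intro compact_UN finite_atMost compact_continuous_image UV continuous_intros)
  moreover have "D \<subseteq> ?K"
  proof
    fix x assume "x \<in> D"
    then obtain n where "n \<le> N" "r ^ n * x \<in> V" using cover by blast
    moreover have "x = inverse (r ^ n) * (r ^ n * x)" using r(2) by simp
    ultimately show "x \<in> ?K" by blast
  qed
  ultimately show thesis using that by blast
qed

lemma av_add_le_max: "av (x + y) \<le> max (av x) (av y)"
proof -
  obtain K where K: "compact K" "D \<subseteq> K" using D_subset_compact .
  have K1: "compact ((+) 1 ` K)" by (intro compact_continuous_image K continuous_intros)
  obtain C where C: "C > 0" "\<And>x. x \<in> (+) 1 ` K \<Longrightarrow> av x \<le> C"
    using av_bounded_on_compact[OF K1] by blast
  \<comment> \<open>1 + D lies in the compact set 1 + K. Factoring out the larger of two elements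
    then gives the general inequality with constant C.\<close>
  have one: "av (1 + x) \<le> C" if "av x \<le> 1" for x
    using C(2)[of "1 + x"] that K(2) by (auto simp: integer_ring_def)
  have quasi1: "av (x + y) \<le> C * av x" if "av y \<le> av x" for x y
  proof (cases "x = 0")
    case True
    then have "y = 0" using that av_nonneg[of y] by (simp add: order_antisym flip: av_eq_0)
    then show ?thesis using True by simp
  next
    case False
    then have "av (y * inverse x) \<le> 1" using that av_pos[OF False] by (simp add: field_simps)
    from one[OF this] have "av (x * (1 + y * inverse x)) \<le> av x * C"
      by (simp only: av_mult mult_left_mono av_nonneg)
    moreover have "x * (1 + y * inverse x) = x + y" using False by (simp add: field_simps)
    ultimately show ?thesis by (simp add: mult.commute)
  qed
  have quasi: "av (x + y) \<le> C * max (av x) (av y)" for x y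
    using quasi1[of y x] quasi1[of x y] by (simp add: add.commute max_def)
  have p: "prime CHAR('a)" using prime_CHAR_semidom[where 'a='a] char_eq char_pos by simp
  let ?m = "max (av x) (av y)"
  show ?thesis
  proof (cases "?m = 0")
    case True
    then have "x = 0" "y = 0" using av_nonneg[of x] av_nonneg[of y] by (metis av_eq_0 max.cobounded1 max.cobounded2 order_antisym)+
    then show ?thesis by simp
  next
    case False
    then have m: "?m > 0" using av_nonneg[of x] by linarith
    show ?thesis
    proof (rule ccontr)
      assume "\<not> ?thesis"
      then have "av (x + y) / ?m > 1" using m by (auto simp: not_le le_max_iff_disj)
      then obtain n where n: "C < (av (x + y) / ?m) ^ n" using real_arch_pow by blast
      let ?q = "CHAR('a) ^ n"
      \<comment> \<open>The ratio exceeds 1, so the exponent n may be raised to a power of the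
        characteristic, where the power of the sum is the sum of the powers.\<close>
      have "n \<le> ?q" using p by (meson less_exp less_imp_le order_trans power_mono prime_ge_2_nat zero_le)
      then have "(av (x + y) / ?m) ^ n \<le> (av (x + y) / ?m) ^ ?q"
        using \<open>av (x + y) / ?m > 1\<close> by (intro power_increasing) auto
      also have "\<dots> = av (x ^ ?q + y ^ ?q) / ?m ^ ?q"
        using freshmans_dream'[OF p refl, of x y n] by (simp add: power_divide flip: av_power)
      also have "\<dots> \<le> C * max (av (x ^ ?q)) (av (y ^ ?q)) / ?m ^ ?q"
        using m by (intro divide_right_mono quasi) auto
      also have "max (av (x ^ ?q)) (av (y ^ ?q)) = ?m ^ ?q"
        unfolding av_power by (auto simp: max_def power_mono intro: antisym power_mono)
      also have "C * ?m ^ ?q / ?m ^ ?q = C" using m by simp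
      finally show False using n by simp
    qed
  qed
qed

lemma av_diff_le_max: "av (x - y) \<le> max (av x) (av y)"
  using av_add_le_max[of x "- y"] by simp

lemma av_add_eq: assumes "av y < av x" shows "av (x + y) = av x"
  using av_add_le_max[of x y] av_diff_le_max[of "x + y" y] assms by auto

end

section \<open>The translation set\<close>

text \<open>By induction: passing from modulus c^n to c^(n+1) only brings in the digit of index
  n.\<close>

lemma mod_power_eq_if_digits_eq:
  fixes a b c :: nat
  assumes "\<And>k. k < n \<Longrightarrow> (a div c ^ k) mod c = (b div c ^ k) mod c"
  shows "a mod c ^ n = b mod c ^ n"
  using assms
proof (induction n)
  case (Suc n)
  have "a mod (c ^ n * c) = b mod (c ^ n * c)"
    unfolding mod_mult2_eq using Suc by simp
  then show ?case by (simp add: mult.commute)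
qed simp

context positive_char_local_field
begin

lemma prime_p: "prime p"
  using prime_CHAR_semidom[where 'a='a] char_eq char_pos by simp

lemma q_ge_2: "q \<ge> 2"
proof -
  have "2 \<le> p" using prime_p by (rule prime_ge_2_nat)
  also have "p \<le> p ^ m" using char_pos m_pos by (intro self_le_power) auto
  finally show ?thesis by (simp add: q_eq)
qed

lemma av_sum_le:
  assumes "b \<ge> 0" "\<And>i. i \<in> F \<Longrightarrow> av (f i) \<le> b"
  shows "av (sum f F) \<le> b"
  using assms(2)
proof (induction F rule: infinite_finite_induct)
  case (insert x F)
  have "max (av (f x)) (av (sum f F)) \<le> b" using insert by simp
  then have "av (f x + sum f F) \<le> b" using av_add_le_max by (rule order_trans[rotated])
  then show ?case using insert.hyps by simp
qed (use assms(1) in auto)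

lemma av_of_nat_le: "av (of_nat n) \<le> 1"
proof (induction n)
  case (Suc n)
  then show ?case using av_add_le_max[of 1 "of_nat n"] by simp
qed simp

lemma av_eps: "k < m \<Longrightarrow> av (\<epsilon> k) = 1"
  using eps_basis by (force simp: residue_basis_def integer_ring_def prime_ideal_def)

abbreviation residue_comb :: "nat \<Rightarrow> 'a" where
  "residue_comb n \<equiv> \<Sum>k<m. of_nat ((n div p ^ k) mod p) * \<epsilon> k"

lemma av_residue_comb_diff:
  assumes "n < q" "n' < q" "n \<noteq> n'"
  shows "av (residue_comb n - residue_comb n') = 1"
proof -
  let ?a = "\<lambda>k. (n div p ^ k) mod p" and ?a' = "\<lambda>k. (n' div p ^ k) mod p"
  \<comment> \<open>The digit differences are brought back into 0, ..., p - 1, the range for which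
    \<open>residue_basis\<close> states independence; in characteristic p this does not change their
    images in the field.\<close>
  define d where "d k = (?a k + (p - ?a' k)) mod p" for k
  have of_nat_d: "of_nat (d k) = (of_nat (?a k) - of_nat (?a' k) :: 'a)" for k
  proof -
    have "?a' k < p" using char_pos by simp
    then have "of_nat (p - ?a' k) = (- of_nat (?a' k) :: 'a)"
      using of_nat_CHAR[where 'a='a] by (simp add: of_nat_diff char_eq)
    moreover have "of_nat (d k) = (of_nat (?a k + (p - ?a' k)) :: 'a)"
      unfolding of_nat_eq_iff_cong_CHAR char_eq d_def by (simp add: cong_def)
    ultimately show ?thesis by simp
  qed
  have diff: "residue_comb n - residue_comb n' = (\<Sum>k<m. of_nat (d k) * \<epsilon> k)"
    by (simp add: of_nat_d left_diff_distrib sum_subtractf)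
  have le: "av (residue_comb n - residue_comb n') \<le> 1"
    unfolding diff by (rule av_sum_le) (auto simp: av_eps av_of_nat_le)
  have "\<not> av (residue_comb n - residue_comb n') < 1"
  proof
    assume "av (residue_comb n - residue_comb n') < 1"
    then have "(\<Sum>k<m. of_nat (d k) * \<epsilon> k) \<in> P" using diff by (simp add: prime_ideal_def)
    moreover have "\<forall>k<m. d k < p" using char_pos by (simp add: d_def)
    ultimately have d0: "\<And>k. k < m \<Longrightarrow> d k = 0" using eps_basis unfolding residue_basis_def by blast
    have "n mod p ^ m = n' mod p ^ m"
    proof (rule mod_power_eq_if_digits_eq)
      fix k assume "k < m"
      then have "of_nat (?a k) = (of_nat (?a' k) :: 'a)" using of_nat_d[of k] d0 by simp
      then show "?a k = ?a' k" by (simp add: of_nat_eq_iff_cong_CHAR char_eq cong_def)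
    qed
    then show False using assms by (simp add: q_eq)
  qed
  then show ?thesis using le by simp
qed

abbreviation u :: "nat \<Rightarrow> 'a" where "u \<equiv> coset_rep p m q \<epsilon> \<pi>"

text \<open>Padding with zero digits lets two values of \<open>u\<close> be compared over a common
  index range.\<close>

lemma u_eq_sum:
  assumes "n \<le> N"
  shows "u n = (\<Sum>k\<le>N. u_digit p m \<epsilon> \<pi> ((n div q ^ k) mod q) * inverse \<pi> ^ k)"
  unfolding coset_rep_def
proof (rule sum.mono_neutral_left)
  show "\<forall>k\<in>{..N} - {..n}. u_digit p m \<epsilon> \<pi> ((n div q ^ k) mod q) * inverse \<pi> ^ k = 0"
  proof
    fix k assume "k \<in> {..N} - {..n}"
    then have "n < k" by simp
    also have "k < q ^ k" using q_ge_2 by (intro power_gt_expt) simp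
    finally show "u_digit p m \<epsilon> \<pi> ((n div q ^ k) mod q) * inverse \<pi> ^ k = 0"
      by (simp add: u_digit_def)
  qed
qed (use assms in auto)

text \<open>The digits of highest index where \<open>n\<close> and \<open>n'\<close> differ contribute the dominant term.\<close>

lemma av_u_diff:
  assumes "n \<noteq> n'"
  shows "av (u n - u n') > 1"
proof -
  define N where "N = max n n'"
  define e where "e k = residue_comb ((n div q ^ k) mod q) - residue_comb ((n' div q ^ k) mod q)" for k
  \<comment> \<open>The exponent is Suc k because \<open>u_digit\<close> carries its own factor
    \<open>inverse\<close> \<pi>; hence even a difference in the lowest digit alone has value above
    1.\<close>
  have diff: "u n - u n' = (\<Sum>k\<le>N. e k * inverse \<pi> ^ Suc k)"
    by (simp add: u_eq_sum[of n N] u_eq_sum[of n' N] N_def e_def u_digit_def left_diff_distrib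
        sum_subtractf mult.assoc)
  let ?S = "{k. k \<le> N \<and> (n div q ^ k) mod q \<noteq> (n' div q ^ k) mod q}"
  have "?S \<noteq> {}"
  proof
    assume "?S = {}"
    \<comment> \<open>All digits up to index N agree, and both numbers are at most N < q^(N+1), so
      reducing them changes nothing.\<close>
    then have "n mod q ^ Suc N = n' mod q ^ Suc N"
      by (intro mod_power_eq_if_digits_eq) auto
    moreover have "Suc N < q ^ Suc N" using q_ge_2 by (intro power_gt_expt) simp
    moreover have "n \<le> N" "n' \<le> N" by (auto simp: N_def)
    ultimately show False using assms by simp
  qed
  define t where "t = Max ?S"
  have fin: "finite ?S" by simp
  have t: "t \<in> ?S" unfolding t_def using Max_in[OF fin \<open>?S \<noteq> {}\<close>] .
  have above: "e k = 0" if "k \<le> N" "t < k" for k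
  proof -
    have "k \<notin> ?S"
    proof
      assume "k \<in> ?S"
      then have "k \<le> t" unfolding t_def by (rule Max_ge[OF fin])
      then show False using that by simp
    qed
    then show ?thesis using that by (simp add: e_def)
  qed
  have et: "av (e t) = 1"
    unfolding e_def using t q_ge_2 by (intro av_residue_comb_diff) auto
  have e_le: "av (e k) \<le> 1" for k
    using av_residue_comb_diff[of "(n div q ^ k) mod q" "(n' div q ^ k) mod q"] q_ge_2
    unfolding e_def by (cases "(n div q ^ k) mod q = (n' div q ^ k) mod q") auto
  let ?c = "inverse (av \<pi>)"
  have c: "?c > 1" using av_pi by (simp add: one_less_inverse_iff)
  have "u n - u n' = (\<Sum>k\<le>t. e k * inverse \<pi> ^ Suc k)"
    unfolding diff using t by (intro sum.mono_neutral_right) (auto simp: above)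
  then have eq: "u n - u n' = e t * inverse \<pi> ^ Suc t + (\<Sum>k<t. e k * inverse \<pi> ^ Suc k)"
    unfolding lessThan_Suc_atMost[symmetric] by simp
  have "av (\<Sum>k<t. e k * inverse \<pi> ^ Suc k) \<le> ?c ^ t"
  proof (rule av_sum_le)
    fix k assume "k \<in> {..<t}"
    then have "av (e k) * ?c ^ Suc k \<le> 1 * ?c ^ t"
      using e_le c by (intro mult_mono power_increasing) auto
    then show "av (e k * inverse \<pi> ^ Suc k) \<le> ?c ^ t" by simp
  qed (use c in simp)
  also have "\<dots> < ?c ^ Suc t" using c by (intro power_strict_increasing) auto
  also have "\<dots> = av (e t * inverse \<pi> ^ Suc t)" using et by simp
  finally have "av (u n - u n') = av (e t * inverse \<pi> ^ Suc t)"
    unfolding eq by (rule av_add_eq)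
  also have "\<dots> = ?c ^ Suc t" using et by simp
  also have "\<dots> > 1" using c by (intro one_less_power) auto
  finally show ?thesis .
qed

end

section \<open>Affine changes of variable\<close>

context positive_char_local_field
begin

lemma affine_measurable: "(\<lambda>y. \<alpha> * y + b) \<in> measurable M M"
proof -
  have "continuous_on UNIV (\<lambda>y::'a. \<alpha> * y + b)" by (intro continuous_intros)
  then have "(\<lambda>y. \<alpha> * y + b) \<in> measurable borel borel" by (rule borel_measurable_continuous_onI)
  then show ?thesis using measurable_cong_sets[OF sets_eq sets_eq] by simp
qed

lemma affine_vimage:
  fixes \<alpha> b :: 'a
  assumes "\<alpha> \<noteq> 0"
  shows "(\<lambda>y. \<alpha> * y + b) -` A = (*) (inverse \<alpha>) ` (+) (- b) ` A"
proof -
  have "(+) (- b) ` A = {x. x + b \<in> A}"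
  proof safe
    fix x assume "x + b \<in> A"
    then have "- b + (x + b) \<in> (+) (- b) ` A" by (rule imageI)
    then show "x \<in> (+) (- b) ` A" by (simp only: add.commute[of x] minus_add_cancel)
  qed simp
  moreover have nz: "inverse \<alpha> \<noteq> 0" using assms by simp
  ultimately show ?thesis
    by (simp only: mult_image_eq[OF nz] inverse_inverse_eq vimage_def mem_Collect_eq)
qed

lemma emeasure_affine_vimage:
  assumes "\<alpha> \<noteq> 0" "A \<in> sets M"
  shows "emeasure M ((\<lambda>y. \<alpha> * y + b) -` A) = ennreal (1 / av \<alpha>) * emeasure M A"
proof -
  have "(+) (- b) ` A = (\<lambda>y. 1 * y + b) -` A" by (subst affine_vimage) (auto simp: image_image)
  then have "(+) (- b) ` A \<in> sets M"
    using measurable_sets[OF affine_measurable[of 1 b] assms(2)] space_eq by simp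
  then have "emeasure M ((*) (inverse \<alpha>) ` (+) (- b) ` A) = ennreal (av (inverse \<alpha>)) * emeasure M ((+) (- b) ` A)"
    using assms(1) by (intro emeasure_dilate) simp
  then show ?thesis
    by (simp only: affine_vimage[OF assms(1)] emeasure_translate[OF assms(2)] av_inverse divide_inverse mult_1_left)
qed

text \<open>The pushforward is a constant multiple of the measure, so substitution in integrals and
  preservation of integrability reduce to facts about constant densities.\<close>

lemma distr_affine:
  assumes "\<alpha> \<noteq> 0"
  shows "distr M M (\<lambda>y. \<alpha> * y + b) = density M (\<lambda>_. ennreal (1 / av \<alpha>))"
proof (rule measure_eqI)
  fix A assume "A \<in> sets (distr M M (\<lambda>y. \<alpha> * y + b))"
  then have A: "A \<in> sets M" by simp
  then show "emeasure (distr M M (\<lambda>y. \<alpha> * y + b)) A = emeasure (density M (\<lambda>_. ennreal (1 / av \<alpha>))) A"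
    using emeasure_affine_vimage[OF assms A]
    by (simp add: emeasure_distr affine_measurable emeasure_density_const space_eq)
qed simp

lemma integral_affine:
  fixes f :: "'a \<Rightarrow> 'b::{banach, second_countable_topology}"
  assumes "\<alpha> \<noteq> 0" "f \<in> borel_measurable M"
  shows "(LINT x|M. f x) = av \<alpha> *\<^sub>R (LINT y|M. f (\<alpha> * y + b))"
proof -
  have "(LINT y|M. f (\<alpha> * y + b)) = integral\<^sup>L (density M (\<lambda>_. ennreal (1 / av \<alpha>))) f"
    by (simp add: integral_distr[OF affine_measurable assms(2), symmetric] distr_affine[OF assms(1)])
  also have "\<dots> = (1 / av \<alpha>) *\<^sub>R (LINT x|M. f x)"
    using assms by (simp add: integral_density)
  finally show ?thesis using assms(1) by simp
qed

lemma integrable_affine: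
  fixes f :: "'a \<Rightarrow> 'b::{banach, second_countable_topology}"
  assumes "\<alpha> \<noteq> 0" "integrable M f"
  shows "integrable M (\<lambda>y. f (\<alpha> * y + b))"
proof -
  have "f \<in> borel_measurable M" using assms by simp
  moreover have "integrable (density M (\<lambda>_. ennreal (1 / av \<alpha>))) f"
    using assms by (subst integrable_density) auto
  ultimately show ?thesis
    using integrable_distr[OF affine_measurable] distr_affine[OF assms(1), of b] by metis
qed

end

section \<open>Bessel's inequality and Haar wavelets\<close>

lemma L2_norm_sq: "(L2_norm M f)\<^sup>2 = (LINT x|M. (cmod (f x))\<^sup>2)"
  by (simp add: L2_norm_def)

lemma L2_mult_integrable:
  assumes "f \<in> L2 M" "g \<in> L2 M"
  shows "integrable M (\<lambda>x. f x * cnj (g x))"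
proof (rule Bochner_Integration.integrable_bound)
  show "integrable M (\<lambda>x. (cmod (f x))\<^sup>2 + (cmod (g x))\<^sup>2)"
    using assms by (simp add: L2_def)
  have "f \<in> borel_measurable M" "g \<in> borel_measurable M" using assms by (auto simp: L2_def)
  then show "(\<lambda>x. f x * cnj (g x)) \<in> borel_measurable M"
    by (intro borel_measurable_times borel_measurable_continuous_on[where f=cnj] continuous_intros)
  have "a * b \<le> a\<^sup>2 + b\<^sup>2" for a b :: real
    using sum_squares_bound[of a b] zero_le_power2[of a] zero_le_power2[of b]
    unfolding mult.assoc by linarith
  then show "AE x in M. norm (f x * cnj (g x)) \<le> norm ((cmod (f x))\<^sup>2 + (cmod (g x))\<^sup>2)"
    by (simp add: norm_mult)
qed

lemma L2_diff_scale:
  assumes "f \<in> L2 M" "g \<in> L2 M"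
  shows "(\<lambda>x. f x - c * g x) \<in> L2 M"
    and "(L2_norm M (\<lambda>x. f x - c * g x))\<^sup>2 =
      (L2_norm M f)\<^sup>2 - 2 * Re (c * L2_inner M g f) + (cmod c)\<^sup>2 * (L2_norm M g)\<^sup>2"
proof -
  have meas: "f \<in> borel_measurable M" "g \<in> borel_measurable M" using assms by (auto simp: L2_def)
  have int: "integrable M (\<lambda>x. (cmod (f x))\<^sup>2)" "integrable M (\<lambda>x. (cmod (g x))\<^sup>2)"
    using assms by (auto simp: L2_def)
  have fg: "integrable M (\<lambda>x. g x * cnj (f x))" by (rule L2_mult_integrable[OF assms(2,1)])
  define R where "R = (\<lambda>x. Re (c * (g x * cnj (f x))))"
  have re: "integrable M R"
    unfolding R_def by (intro integrable_Re integrable_mult_right fg)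
  have pw: "(cmod (f x - c * g x))\<^sup>2 = (cmod (f x))\<^sup>2 - 2 * R x + (cmod c)\<^sup>2 * (cmod (g x))\<^sup>2" for x
    unfolding cmod_power2 R_def by (simp add: power2_eq_square algebra_simps)
  have "integrable M (\<lambda>x. (cmod (f x - c * g x))\<^sup>2)"
    unfolding pw
    by (intro Bochner_Integration.integrable_add Bochner_Integration.integrable_diff
        integrable_mult_right int re)
  then show "(\<lambda>x. f x - c * g x) \<in> L2 M" unfolding L2_def using meas by simp
  have "(LINT x|M. R x) = Re (c * L2_inner M g f)"
    unfolding L2_inner_def R_def using fg by (subst integral_Re) auto
  then show "(L2_norm M (\<lambda>x. f x - c * g x))\<^sup>2 =
      (L2_norm M f)\<^sup>2 - 2 * Re (c * L2_inner M g f) + (cmod c)\<^sup>2 * (L2_norm M g)\<^sup>2"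
    unfolding L2_norm_sq pw using int re by simp
qed

lemma L2_inner_diff_scale_right:
  assumes "f \<in> L2 M" "g \<in> L2 M" "h \<in> L2 M"
  shows "L2_inner M h (\<lambda>x. f x - c * g x) = L2_inner M h f - cnj c * L2_inner M h g"
proof -
  have "L2_inner M h (\<lambda>x. f x - c * g x) = (LINT x|M. h x * cnj (f x) - cnj c * (h x * cnj (g x)))"
    unfolding L2_inner_def by (intro Bochner_Integration.integral_cong) (auto simp: algebra_simps)
  then show ?thesis
    using L2_mult_integrable[OF assms(3,1)] L2_mult_integrable[OF assms(3,2)]
    by (simp add: L2_inner_def)
qed

lemma L2_inner_commute: "L2_inner M g f = cnj (L2_inner M f g)"
  proof -
  have "cnj (LINT x|M. f x * cnj (g x)) = (LINT x|M. cnj (f x * cnj (g x)))"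
    by (rule integral_bounded_linear'[OF bounded_linear_cnj bounded_linear_cnj, symmetric]) simp
  then show ?thesis by (simp add: L2_inner_def mult.commute)
qed

text \<open>Induction by projection: subtracting from \<psi> its component along g i lowers the
  squared norm by exactly the term of i and, by orthogonality, leaves the other coefficients
  unchanged.\<close>

lemma L2_bessel:
  assumes "finite F" "\<psi> \<in> L2 M" "\<And>i. i \<in> F \<Longrightarrow> g i \<in> L2 M" "\<And>i. i \<in> F \<Longrightarrow> L2_norm M (g i) \<noteq> 0"
    and "\<And>i j. i \<in> F \<Longrightarrow> j \<in> F \<Longrightarrow> i \<noteq> j \<Longrightarrow> L2_inner M (g i) (g j) = 0"
  shows "(\<Sum>i\<in>F. (cmod (L2_inner M (g i) \<psi>))\<^sup>2 / (L2_norm M (g i))\<^sup>2) \<le> (L2_norm M \<psi>)\<^sup>2"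
  using assms
proof (induction F arbitrary: \<psi>)
  case (insert i F)
  let ?n = "(L2_norm M (g i))\<^sup>2"
  let ?z = "L2_inner M (g i) \<psi>"
  \<comment> \<open>The projection coefficient of \<psi> along g i; the conjugate is there because
    ?z has \<psi> in the second slot.\<close>
  define c where "c = cnj ?z / of_real ?n"
  define \<psi>' where "\<psi>' = (\<lambda>x. \<psi> x - c * g i x)"
  have gi: "g i \<in> L2 M" "?n > 0" using insert.prems by auto
  have L2': "\<psi>' \<in> L2 M" unfolding \<psi>'_def by (rule L2_diff_scale[OF insert.prems(1) gi(1)])
  have "c * ?z = of_real ((cmod ?z)\<^sup>2 / ?n)"
    by (simp add: c_def complex_norm_square[symmetric] mult.commute del: of_real_power flip: of_real_power)
  moreover have "(cmod c)\<^sup>2 * ?n = (cmod ?z)\<^sup>2 / ?n"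
    using gi(2) by (simp add: c_def norm_divide norm_power power_divide) (simp add: field_simps eval_nat_numeral)
  ultimately have norm': "(L2_norm M \<psi>')\<^sup>2 = (L2_norm M \<psi>)\<^sup>2 - (cmod ?z)\<^sup>2 / ?n"
    unfolding \<psi>'_def L2_diff_scale(2)[OF insert.prems(1) gi(1)] by simp
  have inner': "L2_inner M (g j) \<psi>' = L2_inner M (g j) \<psi>" if "j \<in> F" for j
  proof -
    have "L2_inner M (g j) (g i) = 0" using insert that by (intro insert.prems(4)) auto
    then show ?thesis
      unfolding \<psi>'_def using L2_inner_diff_scale_right[OF insert.prems(1) gi(1), of "g j" c] insert.prems(2) that
      by simp
  qed
  have "(\<Sum>j\<in>F. (cmod (L2_inner M (g j) \<psi>'))\<^sup>2 / (L2_norm M (g j))\<^sup>2) \<le> (L2_norm M \<psi>')\<^sup>2"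
    using L2' insert.prems by (intro insert.IH) auto
  then show ?case using insert.hyps by (simp add: inner' norm')
qed simp

section \<open>Haar wavelets and their orthogonality\<close>

context positive_char_local_field
begin

text \<open>Maximality of |\<pi>| makes P the closed ball of radius |\<pi>|, so its measurability
  and measure come from those of D.\<close>

lemma P_eq: "P = (*) \<pi> ` D"
proof -
  have "P = {x. av x \<le> av \<pi>}"
    using prime_elt av_pi unfolding prime_element_def prime_ideal_def by auto
  also have "\<dots> = {x. inverse \<pi> * x \<in> D}"
    using av_pi by (auto simp: integer_ring_def field_simps)
  finally show ?thesis by (simp only: mult_image_eq[OF pi_nz])
qed

lemma P_sets: "P \<in> sets M" unfolding P_eq by (rule image_mult_sets[OF pi_nz D_sets])

lemma emeasure_P: "emeasure M P = ennreal (av \<pi>)" unfolding P_eq by (rule ennreal_av[OF pi_nz])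

text \<open>The cosets P and 1 + P are disjoint and of equal measure, so the function has mean zero;
  it is supported in D and invariant under P.\<close>

definition haar_wavelet :: "'a \<Rightarrow> complex" where
  "haar_wavelet x = indicator P x - indicator P (x - 1)"

text \<open>Not normalized. The support lies in \<pi>^(-n) (t + D), so a larger n means a coarser
  scale. The affine form matches \<open>integral_affine\<close>.\<close>

definition wavelet :: "int \<Rightarrow> 'a \<Rightarrow> 'a \<Rightarrow> complex" where
  "wavelet n t y = haar_wavelet (\<pi> powi n * y + (- t))"

lemma haar_wavelet_support: "haar_wavelet x \<noteq> 0 \<Longrightarrow> av x \<le> 1"
  using av_add_le_max[of "x - 1" 1]
  by (cases "av x < 1"; cases "av (x - 1) < 1") (auto simp: haar_wavelet_def prime_ideal_def)

lemma P_add_iff: "av d < 1 \<Longrightarrow> x + d \<in> P \<longleftrightarrow> x \<in> P"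
  using av_add_le_max[of x d] av_diff_le_max[of "x + d" d] by (auto simp: prime_ideal_def)

lemma haar_wavelet_add: "av d < 1 \<Longrightarrow> haar_wavelet (x + d) = haar_wavelet x"
  using P_add_iff[of d x] P_add_iff[of d "x - 1"]
  by (auto simp: haar_wavelet_def indicator_def algebra_simps)

lemma indicator_P_integrable: "integrable M (indicator P :: 'a \<Rightarrow> real)"
  using P_sets by (simp add: emeasure_P)

lemma integral_indicator_P: "(LINT x|M. indicator P x) = av \<pi>"
  using P_sets emeasure_P by (simp add: measure_def space_eq)

lemma shifted_indicator_P_integrable: "integrable M (\<lambda>x. indicator P (x - 1) :: real)"
  using integrable_affine[of 1 _ "-1", OF _ indicator_P_integrable] by simp

lemma integral_shifted_indicator_P: "(LINT x|M. indicator P (x - 1)) = av \<pi>"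
  using integral_affine[of 1 "indicator P :: 'a \<Rightarrow> real" "-1"] indicator_P_integrable integral_indicator_P
  by simp

lemma haar_wavelet_of_real:
  "haar_wavelet = (\<lambda>x. of_real (indicator P x - indicator P (x - 1)))"
  by (auto simp: haar_wavelet_def indicator_def)

lemma haar_wavelet_integrable: "integrable M haar_wavelet"
  unfolding haar_wavelet_of_real
  by (intro integrable_of_real Bochner_Integration.integrable_diff indicator_P_integrable
      shifted_indicator_P_integrable)

lemma integral_haar_wavelet: "(LINT x|M. haar_wavelet x) = 0"
  unfolding haar_wavelet_of_real integral_complex_of_real
  using indicator_P_integrable shifted_indicator_P_integrable integral_indicator_P
    integral_shifted_indicator_P by simp

text \<open>The two indicators have disjoint supports, since x - (x - 1) = 1 has value 1; hence
  there is no cross term.\<close>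

lemma cmod_haar_wavelet_sq:
  "(cmod (haar_wavelet x))\<^sup>2 = indicator P x + indicator P (x - 1)"
proof -
  have "\<not> (av x < 1 \<and> av (x - 1) < 1)" using av_diff_le_max[of x "x - 1"] by auto
  then show ?thesis by (auto simp: haar_wavelet_def indicator_def prime_ideal_def)
qed

lemma integral_haar_wavelet_sq:
  "integrable M (\<lambda>x. (cmod (haar_wavelet x))\<^sup>2)" "(LINT x|M. (cmod (haar_wavelet x))\<^sup>2) = 2 * av \<pi>"
  unfolding cmod_haar_wavelet_sq
  using indicator_P_integrable shifted_indicator_P_integrable integral_indicator_P
    integral_shifted_indicator_P by simp_all

lemma wavelet_integrable: "integrable M (wavelet n t)"
  unfolding wavelet_def by (rule integrable_affine[OF _ haar_wavelet_integrable]) simp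

lemma wavelet_L2: "wavelet n t \<in> L2 M"
proof -
  have "integrable M (\<lambda>y. (cmod (wavelet n t y))\<^sup>2)"
    unfolding wavelet_def by (rule integrable_affine[OF _ integral_haar_wavelet_sq(1)]) simp
  then show ?thesis using wavelet_integrable[of n t] by (auto simp: L2_def)
qed

lemma wavelet_norm_sq: "(L2_norm M (wavelet n t))\<^sup>2 = 2 * av \<pi> / av \<pi> powi n"
proof -
  have "2 * av \<pi> = av (\<pi> powi n) *\<^sub>R (LINT y|M. (cmod (wavelet n t y))\<^sup>2)"
    unfolding integral_haar_wavelet_sq(2)[symmetric] wavelet_def
    using integral_haar_wavelet_sq(1) by (intro integral_affine) auto
  then show ?thesis unfolding L2_norm_sq using av_pi(1) by (simp add: field_simps)
qed

lemma integral_wavelet: "(LINT y|M. wavelet n t y) = 0"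
proof -
  have "0 = av (\<pi> powi n) *\<^sub>R (LINT y|M. wavelet n t y)"
    unfolding integral_haar_wavelet[symmetric] wavelet_def
    using haar_wavelet_integrable by (intro integral_affine) auto
  then show ?thesis by simp
qed

text \<open>The coarser wavelet is constant on the support of the finer one, which has mean zero.\<close>

lemma wavelet_orthogonal_scales:
  assumes "n < n'"
  shows "L2_inner M (wavelet n t) (wavelet n' t') = 0"
proof -
  \<comment> \<open>The centre of the finer support: there \<pi>^n y0 = t.\<close>
  define y0 where "y0 = \<pi> powi (- n) * t"
  have "wavelet n t y * cnj (wavelet n' t' y) = wavelet n t y * cnj (wavelet n' t' y0)" for y
  proof (cases "wavelet n t y = 0")
    case False
    let ?d = "\<pi> powi (n' - n) * (\<pi> powi n * y + (- t))"
    have "av (\<pi> powi n * y + (- t)) \<le> 1" using haar_wavelet_support False by (simp add: wavelet_def)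
    then have "av ?d \<le> av \<pi> powi (n' - n)" by (simp add: mult_left_le)
    also have "av \<pi> powi (n' - n) = av \<pi> ^ nat (n' - n)" using assms by (simp add: power_int_def)
    also have "\<dots> < 1" using assms av_pi by (intro power_less_one_iff[THEN iffD2] conjI) auto
    finally have d: "av ?d < 1" .
    have "\<pi> powi n' * y + (- t') = (\<pi> powi n' * y0 + (- t')) + ?d"
      by (simp add: y0_def algebra_simps power_int_diff power_int_minus field_simps)
    then have "wavelet n' t' y = wavelet n' t' y0"
      unfolding wavelet_def using haar_wavelet_add[OF d] by metis
    then show ?thesis by simp
  qed simp
  then have "L2_inner M (wavelet n t) (wavelet n' t') = (LINT y|M. wavelet n t y * cnj (wavelet n' t' y0))"
    unfolding L2_inner_def by (intro Bochner_Integration.integral_cong refl)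
  then show ?thesis using wavelet_integrable[of n t] integral_wavelet[of n t] by simp
qed

text \<open>The cosets t + D and t' + D are distinct, so the supports are disjoint.\<close>

lemma wavelet_orthogonal_translates:
  assumes "av (t - t') > 1"
  shows "L2_inner M (wavelet n t) (wavelet n t') = 0"
proof -
  have "wavelet n t y = 0 \<or> wavelet n t' y = 0" for y
  proof (rule ccontr)
    assume "\<not> ?thesis"
    then have "av (\<pi> powi n * y + (- t)) \<le> 1" "av (\<pi> powi n * y + (- t')) \<le> 1"
      using haar_wavelet_support by (auto simp: wavelet_def)
    then have "av (t - t') \<le> 1"
      using av_diff_le_max[of "\<pi> powi n * y + (- t')" "\<pi> powi n * y + (- t)"] by simp
    then show False using assms by simp
  qed
  then have "(\<lambda>y. wavelet n t y * cnj (wavelet n t' y)) = (\<lambda>y. 0)" by auto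
  then show ?thesis by (simp add: L2_inner_def)
qed

lemma wavelet_orthogonal:
  assumes "n \<noteq> n' \<or> av (t - t') > 1"
  shows "L2_inner M (wavelet n t) (wavelet n' t') = 0"
proof -
  consider "n < n'" | "n' < n" | "n = n'" "av (t - t') > 1" using assms by linarith
  then show ?thesis
  proof cases
    case 2
    then show ?thesis using L2_inner_commute[of M "wavelet n t"] wavelet_orthogonal_scales by simp
  qed (auto simp: wavelet_orthogonal_scales wavelet_orthogonal_translates)
qed

end

section \<open>Co-affine systems\<close>

lemma ennreal_summable_on: "(f :: 'i \<Rightarrow> ennreal) summable_on X"
  by (rule nonneg_summable_on_complete) simp

lemma ennreal_le_infsum:
  fixes f :: "'i \<Rightarrow> ennreal"
  shows "f a \<le> infsum f UNIV"
proof -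
  have "infsum f {a} \<le> infsum f UNIV" by (rule infsum_mono_neutral) (auto intro: ennreal_summable_on)
  then show ?thesis by simp
qed

lemma sum_infsum_swap_ennreal:
  fixes f :: "'i \<Rightarrow> 'j \<Rightarrow> ennreal"
  shows "(\<Sum>i\<in>I. infsum (f i) X) = infsum (\<lambda>x. \<Sum>i\<in>I. f i x) X"
  by (induction I rule: infinite_finite_induct) (simp_all add: infsum_add ennreal_summable_on)

text \<open>All families in \<open>ennreal\<close> are summable, so the finite sum moves inside and
  each unordered sum is bounded through its finite partial sums. Bessel's inequality then only has
  to be applied to finite families.\<close>

lemma sum_infsum2_le_ennreal:
  fixes a :: "'i \<Rightarrow> 'j \<Rightarrow> 'k \<Rightarrow> ennreal"
  assumes "\<And>J K. finite J \<Longrightarrow> finite K \<Longrightarrow> (\<Sum>i\<in>I. \<Sum>j\<in>J. \<Sum>k\<in>K. a i j k) \<le> C"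
  shows "(\<Sum>i\<in>I. \<Sum>\<^sub>\<infinity>j\<in>UNIV. \<Sum>\<^sub>\<infinity>k\<in>UNIV. a i j k) \<le> C"
  unfolding sum_infsum_swap_ennreal
proof (rule infsum_le_finite_sums)
  fix J :: "'j set" assume J: "finite J"
  show "(\<Sum>j\<in>J. \<Sum>\<^sub>\<infinity>k\<in>UNIV. \<Sum>i\<in>I. a i j k) \<le> C"
    unfolding sum_infsum_swap_ennreal
  proof (rule infsum_le_finite_sums)
    fix K :: "'k set" assume K: "finite K"
    have "(\<Sum>k\<in>K. \<Sum>j\<in>J. \<Sum>i\<in>I. a i j k) = (\<Sum>j\<in>J. \<Sum>k\<in>K. \<Sum>i\<in>I. a i j k)" by (rule sum.swap)
    also have "\<dots> = (\<Sum>j\<in>J. \<Sum>i\<in>I. \<Sum>k\<in>K. a i j k)" by (intro sum.cong refl sum.swap)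
    also have "\<dots> = (\<Sum>i\<in>I. \<Sum>j\<in>J. \<Sum>k\<in>K. a i j k)" by (rule sum.swap)
    finally show "(\<Sum>k\<in>K. \<Sum>j\<in>J. \<Sum>i\<in>I. a i j k) \<le> C" using assms[OF J K] by simp
  qed (rule ennreal_summable_on)
qed (rule ennreal_summable_on)

lemma L2_inner_self: "L2_inner M f f = of_real ((L2_norm M f)\<^sup>2)"
  unfolding L2_inner_def L2_norm_sq integral_complex_of_real[symmetric]
  by (simp only: complex_norm_square)

section \<open>Coefficients of the co-affine system\<close>

context positive_char_local_field
begin

abbreviation "coaffine \<equiv> weighted_coaffine_system p m q \<epsilon> \<pi>"

lemma coaffine_eq:
  "coaffine \<psi> c l j k x =
     (c l j * of_real (real q powr (of_int j / 2))) * \<psi> l (\<pi> powi (- j) * x + (- (\<pi> powi (- j) * u k)))"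
  by (simp add: weighted_coaffine_system_def translation_def dilation_def algebra_simps)

text \<open>The factor by which weight and dilation together change a squared norm; for |\<pi>| =
  1/q it is |z|^2.\<close>

definition coaffine_gain :: "complex \<Rightarrow> int \<Rightarrow> real" where
  "coaffine_gain z j = (cmod z)\<^sup>2 * (real q powr (of_int j / 2))\<^sup>2 * av \<pi> powi j"

lemma coaffine_gain_nonneg: "coaffine_gain z j \<ge> 0"
  by (simp add: coaffine_gain_def)

lemma cmod_coaffine_sq:
  "(cmod (coaffine \<psi> c l j k x))\<^sup>2 = (cmod (c l j))\<^sup>2 * (real q powr (of_int j / 2))\<^sup>2 *
     (cmod (\<psi> l (\<pi> powi (- j) * x + (- (\<pi> powi (- j) * u k)))))\<^sup>2"
  unfolding coaffine_eq by (simp only: norm_mult power_mult_distrib norm_of_real power2_abs)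

lemma coaffine_L2:
  assumes "\<psi> l \<in> L2 M"
  shows "coaffine \<psi> c l j k \<in> L2 M"
proof -
  have nz: "\<pi> powi (- j) \<noteq> 0" by simp
  have \<psi>: "\<psi> l \<in> borel_measurable M" "integrable M (\<lambda>x. (cmod (\<psi> l x))\<^sup>2)" using assms by (auto simp: L2_def)
  have "coaffine \<psi> c l j k \<in> borel_measurable M"
    unfolding coaffine_eq[abs_def]
    by (intro borel_measurable_times borel_measurable_const measurable_compose[OF affine_measurable \<psi>(1)])
  moreover have "integrable M (\<lambda>x. (cmod (coaffine \<psi> c l j k x))\<^sup>2)"
    unfolding cmod_coaffine_sq by (intro integrable_mult_right integrable_affine[OF nz \<psi>(2)])
  ultimately show ?thesis by (simp add: L2_def)
qed

lemma coaffine_norm_sq: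
  assumes "\<psi> l \<in> L2 M"
  shows "(L2_norm M (coaffine \<psi> c l j k))\<^sup>2 = coaffine_gain (c l j) j * (L2_norm M (\<psi> l))\<^sup>2"
proof -
  have nz: "\<pi> powi (- j) \<noteq> 0" by simp
  have "(\<lambda>x. (cmod (\<psi> l x))\<^sup>2) \<in> borel_measurable M" using assms by (auto simp: L2_def)
  from integral_affine[OF nz this, of "- (\<pi> powi (- j) * u k)"]
  have "(L2_norm M (\<psi> l))\<^sup>2 = av \<pi> powi (- j) *
      (LINT x|M. (cmod (\<psi> l (\<pi> powi (- j) * x + (- (\<pi> powi (- j) * u k)))))\<^sup>2)"
    by (simp add: L2_norm_sq)
  then show ?thesis
    unfolding L2_norm_sq[of M "coaffine \<psi> c l j k"] cmod_coaffine_sq coaffine_gain_def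
    using av_pi(1) by (simp add: power_int_minus field_simps)
qed

text \<open>The substitution x = \<pi>^j y + u k undoes dilation and translation on \<psi> and moves
  them to the wavelet: j changes its scale, k its shift.\<close>

lemma wavelet_inner_coaffine:
  assumes "\<psi> l \<in> L2 M"
  shows "L2_inner M (wavelet n t) (coaffine \<psi> c l j k) =
    cnj (c l j) * of_real (real q powr (of_int j / 2)) * of_real (av \<pi> powi j) *
      L2_inner M (wavelet (n + j) (t - \<pi> powi n * u k)) (\<psi> l)"
proof -
  have nz: "\<pi> powi j \<noteq> 0" by simp
  have "(\<lambda>x. wavelet n t x * cnj (coaffine \<psi> c l j k x)) \<in> borel_measurable M"
    using L2_mult_integrable[OF wavelet_L2 coaffine_L2[of \<psi> l c j k, OF assms]] by (rule borel_measurable_integrable)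
  from integral_affine[OF nz this, of "u k"]
  have "L2_inner M (wavelet n t) (coaffine \<psi> c l j k) = of_real (av \<pi> powi j) *
      (LINT y|M. wavelet n t (\<pi> powi j * y + u k) * cnj (coaffine \<psi> c l j k (\<pi> powi j * y + u k)))"
    by (simp add: L2_inner_def scaleR_conv_of_real)
  also have "(\<lambda>y. wavelet n t (\<pi> powi j * y + u k) * cnj (coaffine \<psi> c l j k (\<pi> powi j * y + u k))) =
      (\<lambda>y. (cnj (c l j) * of_real (real q powr (of_int j / 2))) *
        (wavelet (n + j) (t - \<pi> powi n * u k) y * cnj (\<psi> l y)))"
  proof
    fix y
    have "wavelet n t (\<pi> powi j * y + u k) = wavelet (n + j) (t - \<pi> powi n * u k) y"
      by (simp add: wavelet_def power_int_add algebra_simps)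
    moreover have "coaffine \<psi> c l j k (\<pi> powi j * y + u k) = (c l j * of_real (real q powr (of_int j / 2))) * \<psi> l y"
      unfolding coaffine_eq by (simp add: power_int_minus algebra_simps)
    ultimately show "wavelet n t (\<pi> powi j * y + u k) * cnj (coaffine \<psi> c l j k (\<pi> powi j * y + u k)) =
      (cnj (c l j) * of_real (real q powr (of_int j / 2))) *
        (wavelet (n + j) (t - \<pi> powi n * u k) y * cnj (\<psi> l y))" by simp
  qed
  finally show ?thesis by (simp add: L2_inner_def)
qed

text \<open>Written as gain times the squared norm of the test wavelet times a normalized Bessel
  term; this gain is the one that the upper frame bound controls.\<close>

lemma cmod_wavelet_inner_coaffine_sq:
  assumes "\<psi> l \<in> L2 M"
  defines "w \<equiv> \<lambda>n t j k. wavelet (n + j) (t - \<pi> powi n * u k)"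
  shows "(cmod (L2_inner M (wavelet n t) (coaffine \<psi> c l j k)))\<^sup>2 =
    coaffine_gain (c l j) j * (2 * av \<pi> / av \<pi> powi n) *
      ((cmod (L2_inner M (w n t j k) (\<psi> l)))\<^sup>2 / (L2_norm M (w n t j k))\<^sup>2)"
  unfolding wavelet_inner_coaffine[of \<psi> l n t c j k, OF assms(1)] w_def wavelet_norm_sq coaffine_gain_def
    norm_mult norm_of_real complex_mod_cnj power_mult_distrib power2_abs
  using av_pi(1) by (simp add: power_int_add power2_eq_square field_simps)

text \<open>The shift t - \<pi>^n u k of the transported wavelet for n = -s and t = \<pi>^(-s)
  \<pi>^i, that is, for the Haar wavelet at scale s translated by \<pi>^i. It does not depend on
  j.\<close>

definition probe_shift :: "nat \<Rightarrow> nat \<Rightarrow> nat \<Rightarrow> 'a" where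
  "probe_shift s i k = \<pi> powi (- int s) * (\<pi> ^ i - u k)"

text \<open>Before scaling, the difference must exceed |\<pi>|^s. If the k differ, the term u k - u
  k' has value above 1 and dominates; otherwise the value is |\<pi>| to the smaller of i and i',
  which is below s.\<close>

lemma probe_shift_separated:
  assumes "i < s" "i' < s" "(i, k) \<noteq> (i', k')"
  shows "av (probe_shift s i k - probe_shift s i' k') > 1"
proof -
  have lt: "av (\<pi> ^ i - \<pi> ^ i') = av \<pi> ^ i" if "i < i'" for i i'
  proof -
    have "av \<pi> ^ i' < av \<pi> ^ i" using that av_pi by (intro power_strict_decreasing) auto
    then show ?thesis using av_add_eq[of "- (\<pi> ^ i')" "\<pi> ^ i"] by simp
  qed
  have "av ((\<pi> ^ i - \<pi> ^ i') - (u k - u k')) > av \<pi> ^ s"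
  proof (cases "k = k'")
    case True
    have gt: "av \<pi> ^ s < av \<pi> ^ a" if "a < s" for a
      using that av_pi by (intro power_strict_decreasing) auto
    from True assms have "i < i' \<or> i' < i" by auto
    then show ?thesis
    proof
      assume "i < i'" then show ?thesis using lt[of i i'] gt assms True by simp
    next
      assume "i' < i"
      then have "av (\<pi> ^ i - \<pi> ^ i') = av \<pi> ^ i'" using lt[of i' i] av_minus[of "\<pi> ^ i - \<pi> ^ i'"] by simp
      then show ?thesis using gt assms True by simp
    qed
  next
    case False
    have le: "av (\<pi> ^ a) \<le> 1" for a using av_pi by (simp add: power_le_one)
    have "av (\<pi> ^ i - \<pi> ^ i') \<le> 1" using av_diff_le_max[of "\<pi> ^ i" "\<pi> ^ i'"] le[of i] le[of i'] by linarith
    then have "av (\<pi> ^ i - \<pi> ^ i') < av (- (u k - u k'))" using av_u_diff[OF False] by (simp only: av_minus)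
    from av_add_eq[OF this] have "av ((\<pi> ^ i - \<pi> ^ i') - (u k - u k')) = av (u k - u k')"
      by (simp only: av_minus add.commute[of "- _"] diff_conv_add_uminus[symmetric])
    moreover have "av \<pi> ^ s \<le> 1" using av_pi by (simp add: power_le_one)
    ultimately show ?thesis using av_u_diff[OF False] by simp
  qed
  moreover have "av \<pi> ^ s > 0" using av_pi by simp
  ultimately have "1 < av ((\<pi> ^ i - \<pi> ^ i') - (u k - u k')) / av \<pi> ^ s" by simp
  also have "\<dots> = av (\<pi> powi (- int s) * ((\<pi> ^ i - \<pi> ^ i') - (u k - u k')))"
    by (simp only: av_mult av_inverse av_power power_int_minus power_int_of_nat divide_inverse mult.commute)
  also have "\<pi> powi (- int s) * ((\<pi> ^ i - \<pi> ^ i') - (u k - u k')) = probe_shift s i k - probe_shift s i' k'"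
    unfolding probe_shift_def right_diff_distrib by simp
  finally show ?thesis .
qed

text \<open>One Bessel inequality for \<psi> l serves all s probes at once, so the bound is B times
  the squared norm of a single probe, with no factor s.\<close>

lemma probe_coefficients_le:
  fixes J :: "int set" and K :: "nat set"
  assumes "\<psi> l \<in> L2 M" "finite J" "finite K"
    and "\<And>j. coaffine_gain (c l j) j * (L2_norm M (\<psi> l))\<^sup>2 \<le> B"
  shows "(\<Sum>i<s. \<Sum>j\<in>J. \<Sum>k\<in>K.
      (cmod (L2_inner M (wavelet (- int s) (\<pi> powi (- int s) * \<pi> ^ i)) (coaffine \<psi> c l j k)))\<^sup>2)
    \<le> B * (2 * av \<pi> / av \<pi> powi (- int s))"
proof -
  let ?V = "2 * av \<pi> / av \<pi> powi (- int s)"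
  let ?N = "(L2_norm M (\<psi> l))\<^sup>2"
  let ?F = "{..<s} \<times> J \<times> K"
  define w where "w x = (case x of (i, j, k) \<Rightarrow> wavelet (- int s + j) (probe_shift s i k))" for x :: "nat \<times> int \<times> nat"
  define b where "b x = (cmod (L2_inner M (w x) (\<psi> l)))\<^sup>2 / (L2_norm M (w x))\<^sup>2" for x
  have V: "?V > 0" using av_pi by simp
  have b0: "b x \<ge> 0" for x by (simp add: b_def)
  have "(\<Sum>x\<in>?F. b x) \<le> ?N"
    unfolding b_def
  proof (rule L2_bessel)
    fix x assume "x \<in> ?F"
    show "w x \<in> L2 M" by (auto simp: w_def wavelet_L2 split: prod.splits)
    have "(L2_norm M (w x))\<^sup>2 \<noteq> 0"
      using av_pi by (cases x) (auto simp: w_def wavelet_norm_sq)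
    then show "L2_norm M (w x) \<noteq> 0" by auto
  next
    fix x y assume "x \<in> ?F" "y \<in> ?F" "x \<noteq> y"
    moreover obtain i j k where x: "x = (i, j, k)" by (rule prod_cases3)
    moreover obtain i' j' k' where y: "y = (i', j', k')" by (rule prod_cases3)
    \<comment> \<open>Different j give different scales; for equal j the shifts are
      separated.\<close>
    ultimately have "i < s" "i' < s" "j = j' \<Longrightarrow> (i, k) \<noteq> (i', k')" by auto
    then show "L2_inner M (w x) (w y) = 0"
      unfolding w_def x y using probe_shift_separated[of i s i' k k'] by (auto intro!: wavelet_orthogonal)
  qed (use assms in auto)
  then have sum_b: "(\<Sum>x\<in>?F. b x) \<le> ?N" .
  \<comment> \<open>If \<psi> l has norm 0, the quotient B / ?N is 0 by default and bounds no gain,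
    but then Bessel's inequality makes every b x vanish.\<close>
  have gain: "coaffine_gain (c l j) j * b x \<le> B / ?N * b x" if "x \<in> ?F" for j x
  proof (cases "?N = 0")
    case True
    then have "(\<Sum>x\<in>?F. b x) = 0" using sum_b b0 by (intro antisym sum_nonneg) auto
    then have "b x = 0" using that b0 assms by (subst (asm) sum_nonneg_eq_0_iff) auto
    then show ?thesis by simp
  next
    case False
    then have "?N > 0" by simp
    then have "coaffine_gain (c l j) j \<le> B / ?N" using assms(4)[of j] by (simp add: pos_le_divide_eq)
    then show ?thesis using b0 by (rule mult_right_mono)
  qed
  have B0: "B \<ge> 0" using assms(4)[of 0] coaffine_gain_nonneg[of "c l 0" 0]
    by (meson mult_nonneg_nonneg order_trans zero_le_power2)
  have "(\<Sum>i<s. \<Sum>j\<in>J. \<Sum>k\<in>K.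
      (cmod (L2_inner M (wavelet (- int s) (\<pi> powi (- int s) * \<pi> ^ i)) (coaffine \<psi> c l j k)))\<^sup>2)
    = (\<Sum>i<s. \<Sum>j\<in>J. \<Sum>k\<in>K. ?V * (coaffine_gain (c l j) j * b (i, j, k)))"
    by (intro sum.cong refl)
      (simp add: cmod_wavelet_inner_coaffine_sq[of \<psi> l, OF assms(1)] b_def w_def probe_shift_def right_diff_distrib)
  also have "\<dots> \<le> (\<Sum>i<s. \<Sum>j\<in>J. \<Sum>k\<in>K. ?V * (B / ?N * b (i, j, k)))"
    using V by (intro sum_mono mult_left_mono gain) auto
  also have "\<dots> = ?V * (B / ?N) * (\<Sum>x\<in>?F. b x)"
    by (simp add: sum.cartesian_product sum_distrib_left mult.assoc)
  also have "\<dots> \<le> ?V * (B / ?N) * ?N"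
    using V B0 sum_b by (intro mult_left_mono mult_nonneg_nonneg divide_nonneg_nonneg) auto
  also have "\<dots> \<le> B * ?V" using V B0 by (cases "?N = 0") (auto simp: mult.commute)
  finally show ?thesis .
qed

lemma coaffine_gain_le_upper_bound:
  assumes "\<psi> l \<in> L2 M" "l \<in> {1..L}"
    and bound: "\<And>f. f \<in> L2 M \<Longrightarrow>
      (\<Sum>l=1..L. \<Sum>\<^sub>\<infinity>j\<in>UNIV. \<Sum>\<^sub>\<infinity>k\<in>UNIV. ennreal ((cmod (L2_inner M f (coaffine \<psi> c l j k)))\<^sup>2))
        \<le> ennreal (B * (L2_norm M f)\<^sup>2)"
    and "B > 0"
  shows "coaffine_gain (c l j) j * (L2_norm M (\<psi> l))\<^sup>2 \<le> B"
proof -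
  define f where "f = coaffine \<psi> c l j 0"
  let ?a = "\<lambda>l j k. ennreal ((cmod (L2_inner M f (coaffine \<psi> c l j k)))\<^sup>2)"
  have "?a l j 0 \<le> (\<Sum>\<^sub>\<infinity>k\<in>UNIV. ?a l j k)" by (rule ennreal_le_infsum)
  also have "\<dots> \<le> (\<Sum>\<^sub>\<infinity>j\<in>UNIV. \<Sum>\<^sub>\<infinity>k\<in>UNIV. ?a l j k)"
    by (rule ennreal_le_infsum[of "\<lambda>j. \<Sum>\<^sub>\<infinity>k\<in>UNIV. ?a l j k"])
  also have "\<dots> \<le> (\<Sum>l=1..L. \<Sum>\<^sub>\<infinity>j\<in>UNIV. \<Sum>\<^sub>\<infinity>k\<in>UNIV. ?a l j k)"
    using assms(2) by (intro member_le_sum) auto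
  also have "\<dots> \<le> ennreal (B * (L2_norm M f)\<^sup>2)"
    unfolding f_def by (intro bound coaffine_L2 assms(1))
  \<comment> \<open>The coefficient of f against itself contributes the fourth power of its norm;
    dividing by the squared norm gives the bound, which is trivial when the norm is 0.\<close>
  also have "?a l j 0 = ennreal ((L2_norm M f)\<^sup>2 * (L2_norm M f)\<^sup>2)"
    unfolding f_def[symmetric] L2_inner_self norm_of_real by (simp add: power2_eq_square)
  finally have le: "(L2_norm M f)\<^sup>2 * (L2_norm M f)\<^sup>2 \<le> B * (L2_norm M f)\<^sup>2"
    using assms(4) by (subst (asm) ennreal_le_iff) auto
  have "(L2_norm M f)\<^sup>2 \<le> B"
  proof (cases "L2_norm M f = 0")
    case False
    then have "(L2_norm M f)\<^sup>2 > 0" by simp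
    then show ?thesis using le by (rule mult_right_le_imp_le[rotated])
  qed (use assms(4) in simp)
  then show ?thesis unfolding f_def coaffine_norm_sq[of \<psi> l, OF assms(1)] .
qed

lemma coaffine_not_frame:
  assumes "\<And>l. l \<in> {1..L} \<Longrightarrow> \<psi> l \<in> L2 M"
  shows "\<not> is_frame M L (coaffine \<psi> c)"
proof
  assume "is_frame M L (coaffine \<psi> c)"
  then obtain A B :: real where AB: "0 < A" "A \<le> B"
    and lower: "\<And>f. f \<in> L2 M \<Longrightarrow> ennreal (A * (L2_norm M f)\<^sup>2) \<le>
      (\<Sum>l=1..L. \<Sum>\<^sub>\<infinity>j\<in>UNIV. \<Sum>\<^sub>\<infinity>k\<in>UNIV. ennreal ((cmod (L2_inner M f (coaffine \<psi> c l j k)))\<^sup>2))"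
    and upper: "\<And>f. f \<in> L2 M \<Longrightarrow>
      (\<Sum>l=1..L. \<Sum>\<^sub>\<infinity>j\<in>UNIV. \<Sum>\<^sub>\<infinity>k\<in>UNIV. ennreal ((cmod (L2_inner M f (coaffine \<psi> c l j k)))\<^sup>2))
        \<le> ennreal (B * (L2_norm M f)\<^sup>2)"
    unfolding is_frame_def Let_def by blast
  have gain: "coaffine_gain (c l j) j * (L2_norm M (\<psi> l))\<^sup>2 \<le> B" if "l \<in> {1..L}" for l j
    using assms[OF that] that upper AB by (intro coaffine_gain_le_upper_bound) auto
  \<comment> \<open>The s lower bounds are added and compared with the joint upper bound for each l.
    The squared probe norm ?V depends on s but is the same for all i, so it cancels.\<close>
  have le: "real s * A \<le> real L * B" for s
  proof -
    let ?V = "2 * av \<pi> / av \<pi> powi (- int s)"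
    let ?f = "\<lambda>i. wavelet (- int s) (\<pi> powi (- int s) * \<pi> ^ i)"
    let ?a = "\<lambda>l i j k. (cmod (L2_inner M (?f i) (coaffine \<psi> c l j k)))\<^sup>2"
    have V: "?V > 0" using av_pi by simp
    have "ennreal (real s * A * ?V) = (\<Sum>i<s. ennreal (A * ?V))"
      using AB V by (subst sum_ennreal) (auto simp: mult.assoc)
    also have "\<dots> \<le> (\<Sum>i<s. \<Sum>l=1..L. \<Sum>\<^sub>\<infinity>j\<in>UNIV. \<Sum>\<^sub>\<infinity>k\<in>UNIV. ennreal (?a l i j k))"
      using lower[OF wavelet_L2] unfolding wavelet_norm_sq by (intro sum_mono)
    also have "\<dots> = (\<Sum>l=1..L. \<Sum>i<s. \<Sum>\<^sub>\<infinity>j\<in>UNIV. \<Sum>\<^sub>\<infinity>k\<in>UNIV. ennreal (?a l i j k))"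
      by (rule sum.swap)
    also have "\<dots> \<le> (\<Sum>l=1..L. ennreal (B * ?V))"
    proof (intro sum_mono sum_infsum2_le_ennreal)
      fix l and J :: "int set" and K :: "nat set"
      assume "l \<in> {1..L}" "finite J" "finite K"
      then have "(\<Sum>i<s. \<Sum>j\<in>J. \<Sum>k\<in>K. ?a l i j k) \<le> B * ?V"
        by (intro probe_coefficients_le assms gain)
      then show "(\<Sum>i<s. \<Sum>j\<in>J. \<Sum>k\<in>K. ennreal (?a l i j k)) \<le> ennreal (B * ?V)"
        by (simp add: sum_nonneg ennreal_leI)
    qed
    also have "\<dots> = ennreal (real L * B * ?V)"
      using AB V by (subst sum_ennreal) (auto simp: mult.assoc)
    finally have "real s * A * ?V \<le> real L * B * ?V"
      using AB V by (subst (asm) ennreal_le_iff) auto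
    then show ?thesis using V by (rule mult_right_le_imp_le)
  qed
  obtain s :: nat where "real L * B / A < real s" using reals_Archimedean2 by blast
  then show False using le[of s] AB(1) by (simp add: field_simps)
qed

end

theorem theorem5p1:
  fixes M :: "'a::local_field measure"
    and av :: "'a \<Rightarrow> real"
    and p m q L :: nat
    and \<epsilon> :: "nat \<Rightarrow> 'a"
    and \<pi> :: 'a
    and \<psi> :: "nat \<Rightarrow> 'a \<Rightarrow> complex"
    and c :: "nat \<Rightarrow> int \<Rightarrow> complex"
  assumes "positive_char_local_field M av p m q \<epsilon> \<pi>"
    and "\<And>l. l \<in> {1..L} \<Longrightarrow> \<psi> l \<in> L2 M"
  shows "\<not> is_frame M L (weighted_coaffine_system p m q \<epsilon> \<pi> \<psi> c)"
  using positive_char_local_field.coaffine_not_frame[OF assms] .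

end
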